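(* For every $\varepsilon>0$, as $x\to\infty$, $$\sum_{n\le x}s(n)=\frac{x^3}{3}\left(H(3)\left(\log x+2\gamma-\tfrac13\right)+H'(3)\right)+O\!\left(x^{2+\theta+\varepsilon}\right),$$ where $H'$ is the derivative of $H$.
   Context: $\mathbb{N}=\{1,2,\ldots\}$. For $n\in\mathbb{N}$, $s(n)$ denotes the total number of subgroups of the group $\mathbb{Z}_n\times\mathbb{Z}_n\times\mathbb{Z}_n$, where $\mathbb{Z}_n$ is the additive group of residue classes modulo $n$. $\tau(n)$ is the number of positive divisors of $n$, and $\gamma$ is the Euler–Mascheroni constant. The multiplicative arithmetic function $h$ is defined by $$s(n)=\sum_{d\mid n}d^2\tau(d)\,h(n/d)\qquad(n\in\mathbb{N}),$$ and $H(z)=\sum_{n=1}^\infty h(n)n^{-z}$ is the Dirichlet series of $h$. The number $\theta$ is the exponent in Dirichlet's divisor problem, i.e. the (least) real number such that $$\sum_{n\le x}\tau(n)=x\log x+(2\gamma-1)x+O(x^{\theta+\varepsilon})$$ for every $\varepsilon>0$; it is known that $1/4\le\theta\le 131/416$. The implied constant in the $O$-term may depend on $\varepsilon$. *)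

theory Defs
  imports "HOL-Analysis.Analysis" "HOL-Algebra.Elementary_Groups"
    "HOL-Library.Landau_Symbols" "HOL-Real_Asymp.Real_Asymp"
begin

definition subgroup_count :: "nat \<Rightarrow> nat" where
  "subgroup_count n = card {K. subgroup K
     (integer_mod_group n \<times>\<times> integer_mod_group n \<times>\<times> integer_mod_group n)}"

definition divisor_count :: "nat \<Rightarrow> nat" where
  "divisor_count n = card {d. d dvd n}"

text \<open>
  The function \<open>h\<close> determined by \<open>s(n) = (\<Sum>d | d dvd n. d\<^sup>2 * \<tau>(d) * h(n/d))\<close> for \<open>n \<ge> 1\<close>, where
  \<open>s\<close> is \<^const>\<open>subgroup_count\<close> and \<open>\<tau>\<close> is \<^const>\<open>divisor_count\<close>: this identity is solved for
  the summand \<open>d = 1\<close>. See \<open>subgroup_count_eq\<close> for the identity itself and \<open>h_coeff_unique\<close> for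
  the fact that it has no other solution.
\<close>

function h_coeff :: "nat \<Rightarrow> int" where
  "h_coeff n = (if n = 0 then 0 else int (subgroup_count n) -
     (\<Sum>d | d dvd n \<and> d \<noteq> 1. int (d\<^sup>2 * divisor_count d) * h_coeff (n div d)))"
  by pat_completeness auto
termination
  by (relation "Wellfounded.measure id") (auto simp: dvd_def intro!: div_less_dividend)

declare h_coeff.simps [simp del]

lemma sum_dvd_split_1:
  fixes f :: "nat \<Rightarrow> int"
  assumes "n > 0"
  shows "(\<Sum>d | d dvd n. f d) = f 1 + (\<Sum>d | d dvd n \<and> d \<noteq> 1. f d)"
proof -
  have "{d. d dvd n} = insert 1 {d. d dvd n \<and> d \<noteq> 1}"
    by auto
  moreover have "finite {d. d dvd n \<and> d \<noteq> 1}"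
    using assms by (auto intro: finite_subset[OF _ finite_divisors_nat])
  ultimately show ?thesis
    by simp
qed

lemma divisor_count_1 [simp]: "divisor_count (Suc 0) = 1"
  by (simp add: divisor_count_def)

lemma subgroup_count_eq:
  assumes "n > 0"
  shows "int (subgroup_count n) =
    (\<Sum>d | d dvd n. int (d\<^sup>2 * divisor_count d) * h_coeff (n div d))"
  using assms by (simp add: sum_dvd_split_1 h_coeff.simps[of n])

lemma h_coeff_unique:
  assumes "\<And>n. n > 0 \<Longrightarrow> int (subgroup_count n) =
    (\<Sum>d | d dvd n. int (d\<^sup>2 * divisor_count d) * g (n div d))"
  assumes "n > 0"
  shows "g n = h_coeff n"
  using assms(2)
proof (induction n rule: less_induct)
  case (less n)
  have "g (n div d) = h_coeff (n div d)" if "d dvd n" "d \<noteq> 1" for d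
    using that less.prems by (intro less.IH) (auto simp: dvd_def intro!: div_less_dividend)
  hence "(\<Sum>d | d dvd n \<and> d \<noteq> 1. int (d\<^sup>2 * divisor_count d) * g (n div d)) =
         (\<Sum>d | d dvd n \<and> d \<noteq> 1. int (d\<^sup>2 * divisor_count d) * h_coeff (n div d))"
    by (intro sum.cong) auto
  thus ?case
    using assms(1)[OF less.prems] subgroup_count_eq[OF less.prems] less.prems
    by (simp add: sum_dvd_split_1)
qed

definition H_series :: "complex \<Rightarrow> complex" where
  "H_series z = (\<Sum>k. of_int (h_coeff (Suc k)) * of_nat (Suc k) powr (- z))"

text \<open>The sum over \<open>{1..nat \<lfloor>x\<rfloor>}\<close> is the sum over all integers \<open>1 \<le> n \<le> x\<close>.\<close>

definition divisor_error :: "real \<Rightarrow> real" where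
  "divisor_error x = (\<Sum>n = 1..nat \<lfloor>x\<rfloor>. real (divisor_count n)) -
     (x * ln x + (2 * euler_mascheroni - 1) * x)"

definition divisor_problem_bound :: "real \<Rightarrow> bool" where
  "divisor_problem_bound t \<longleftrightarrow> (\<forall>\<epsilon>>0. divisor_error \<in> O[at_top](\<lambda>x. x powr (t + \<epsilon>)))"

definition theta :: real where
  "theta = (LEAST t. divisor_problem_bound t)"

lemma divisor_problem_bound_nonneg:
  assumes "divisor_problem_bound t"
  shows "t \<ge> 0"
proof (rule ccontr)
  assume "\<not> t \<ge> 0"
  hence t: "t < 0" by simp
  define g :: "real \<Rightarrow> real" where
    "g = (\<lambda>x. x * ln x + (2 * euler_mascheroni - 1) * x)"
  have "divisor_error \<in> O(\<lambda>x. x powr (t + - t / 2))"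
    using assms t unfolding divisor_problem_bound_def by (elim allE[of _ "- t / 2"]) simp
  moreover have "(\<lambda>x::real. x powr (t + - t / 2)) \<in> o(\<lambda>_. 1)"
    using t by real_asymp
  ultimately have "divisor_error \<in> o(\<lambda>_. 1)"
    by (rule landau_o.big_small_trans)
  hence lim: "(divisor_error \<longlongrightarrow> 0) at_top"
    by (auto dest: smalloD_tendsto)
  have "filterlim (\<lambda>n. real n) at_top sequentially" "filterlim (\<lambda>n. real n + 1 / 2) at_top sequentially"
    by real_asymp+
  from this[THEN filterlim_compose[OF lim]]
  have "(\<lambda>n. divisor_error (real n) - divisor_error (real n + 1 / 2)) \<longlonglongrightarrow> 0 - 0"
    by (rule tendsto_diff)
  moreover have "nat \<lfloor>real n + 1 / 2\<rfloor> = n" for n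
    by linarith
  hence "divisor_error (real n) - divisor_error (real n + 1 / 2) = g (real n + 1 / 2) - g (real n)" for n
    by (simp add: divisor_error_def g_def)
  ultimately have "(\<lambda>n. g (real n + 1 / 2) - g (real n)) \<longlonglongrightarrow> 0"
    by simp
  moreover have "filterlim (\<lambda>n. g (real n + 1 / 2) - g (real n)) at_top sequentially"
    unfolding g_def by real_asymp
  ultimately show False
    by (meson filterlim_at_top_imp_at_infinity not_tendsto_and_filterlim_at_infinity sequentially_bot)
qed

lemma divisor_problem_bound_2: "divisor_problem_bound 2"
proof -
  have "(\<lambda>x::real. \<Sum>n = 1..nat \<lfloor>x\<rfloor>. real (divisor_count n)) \<in> O(\<lambda>x. x\<^sup>2)"
  proof (rule landau_o.bigI[of 1])
    show "\<forall>\<^sub>F x::real in at_top. norm (\<Sum>n = 1..nat \<lfloor>x\<rfloor>. real (divisor_count n)) \<le> 1 * norm (x\<^sup>2)"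
      using eventually_ge_at_top[of 1]
    proof eventually_elim
      case (elim x)
      have le: "divisor_count n \<le> n" if "n > 0" for n
      proof -
        have "{d. d dvd n} \<subseteq> {1..n}"
          using that by (auto dest: dvd_imp_le intro!: Suc_leI Nat.gr0I)
        from card_mono[OF _ this] show ?thesis
          by (simp add: divisor_count_def)
      qed
      have "real (divisor_count n) \<le> x" if n: "n \<in> {1..nat \<lfloor>x\<rfloor>}" for n
      proof -
        have "real n \<le> x"
          using n elim by (simp add: le_nat_iff le_floor_iff)
        moreover have "divisor_count n \<le> n"
          using n le by simp
        ultimately show ?thesis
          by linarith
      qed
      hence "(\<Sum>n = 1..nat \<lfloor>x\<rfloor>. real (divisor_count n)) \<le> real (card {1..nat \<lfloor>x\<rfloor>}) * x"
        by (rule sum_bounded_above)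
      also have "\<dots> \<le> x * x"
        using elim by (intro mult_right_mono) auto
      finally show ?case
        by (simp add: power2_eq_square sum_nonneg)
    qed
  qed simp
  moreover have "(\<lambda>x. x * ln x + (2 * euler_mascheroni - 1) * x) \<in> O(\<lambda>x::real. x\<^sup>2)"
    by real_asymp
  ultimately have *: "divisor_error \<in> O(\<lambda>x. x\<^sup>2)"
    unfolding divisor_error_def by (rule sum_in_bigo)
  show ?thesis
    unfolding divisor_problem_bound_def
  proof (intro allI impI)
    fix \<epsilon> :: real assume "\<epsilon> > 0"
    hence "(\<lambda>x::real. x\<^sup>2) \<in> O(\<lambda>x. x powr (2 + \<epsilon>))"
      by real_asymp
    with * show "divisor_error \<in> O(\<lambda>x. x powr (2 + \<epsilon>))"
      by (rule landau_o.big_trans)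
  qed
qed

text \<open>The minimum is attained, so \<^const>\<open>theta\<close> is well defined.\<close>

lemma theta_least:
  shows divisor_problem_bound_theta: "divisor_problem_bound theta"
    and theta_le: "divisor_problem_bound t \<Longrightarrow> theta \<le> t"
proof -
  define S where "S = {t. divisor_problem_bound t}"
  have bdd: "bdd_below S" and ne: "S \<noteq> {}"
    using divisor_problem_bound_nonneg divisor_problem_bound_2
    by (auto simp: S_def bdd_below_def)
  have Inf: "divisor_problem_bound (Inf S)"
    unfolding divisor_problem_bound_def
  proof (intro allI impI)
    fix \<epsilon> :: real assume \<epsilon>: "\<epsilon> > 0"
    then obtain t where t: "t \<in> S" "t < Inf S + \<epsilon>"
      using cInf_less_iff[OF ne bdd, of "Inf S + \<epsilon>"] by auto
    hence "Inf S + \<epsilon> - t > 0" and "\<forall>\<epsilon>>0. divisor_error \<in> O(\<lambda>x. x powr (t + \<epsilon>))"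
      by (simp_all add: S_def divisor_problem_bound_def)
    hence "divisor_error \<in> O(\<lambda>x. x powr (t + (Inf S + \<epsilon> - t)))"
      by blast
    thus "divisor_error \<in> O(\<lambda>x. x powr (Inf S + \<epsilon>))"
      by simp
  qed
  moreover have le: "Inf S \<le> t" if "divisor_problem_bound t" for t
    using that bdd by (auto simp: S_def intro: cInf_lower)
  ultimately have "theta = Inf S"
    unfolding theta_def by (intro Least_equality)
  with Inf le show "divisor_problem_bound theta" "divisor_problem_bound t \<Longrightarrow> theta \<le> t"
    by auto
qed

end

theory Submission
  imports Defs "HOL-Number_Theory.Cong"
begin

text \<open>
  Why the theorem holds. By definition of \<^const>\<open>h_coeff\<close>, the function \<open>s\<close> is the Dirichlet
  convolution of \<open>n\<^sup>2 \<tau>(n)\<close> with \<open>h\<close>, so the sum of \<open>s(n)\<close> over \<open>n \<le> x\<close> equals the sum of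
  \<open>h(d) D(x/d)\<close> over all \<open>d\<close>, where \<open>D(y)\<close> is the sum of \<open>m\<^sup>2 \<tau>(m)\<close> over \<open>m \<le> y\<close>.
  Abel summation turns the estimate in Dirichlet's
  divisor problem, which by \<open>theta_least\<close> holds with exponent \<^const>\<open>theta\<close>, into
  \<open>D(y) = P(y) + O(y powr (2 + \<theta> + \<epsilon>))\<close> with \<open>P(y) = y\<^sup>3/3 * (ln y + 2\<gamma> - 1/3)\<close>. The sum of
  \<open>h(d) P(x/d)\<close> over all \<open>d\<close> is exactly the main term of the theorem, because \<open>P(x/d)\<close> contributes
  \<open>d powr (-3)\<close> and \<open>- ln d * d powr (-3)\<close>, whose sums against \<open>h\<close> are \<open>H(3)\<close> and \<open>H'(3)\<close>. What remains is the
  sum of \<open>h(d) (D(x/d) - P(x/d))\<close>. As \<open>\<theta> \<ge> 0\<close>, it has the right size as soon as \<open>\<Sum> |h(d)| d powr (-\<sigma>)\<close>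
  converges for every \<open>\<sigma> > 2\<close>.

  This convergence (\<open>summable_h_coeff\<close>) is the arithmetic heart. It needs the subgroup count itself.
  Subgroups of \<open>\<int>\<^sub>n\<^sup>3\<close> are the same as lattices \<open>L\<close> with \<open>n\<int>\<^sup>3 \<subseteq> L \<subseteq> \<int>\<^sup>3\<close>. Their number is
  multiplicative in \<open>n\<close> by a Chinese remainder argument. A lattice in \<open>\<int> \<times> \<int>\<^sup>2\<close> amounts
  to a lattice \<open>A\<close> in \<open>\<int>\<^sup>2\<close>, the positive generator \<open>b\<close> of its first coordinates, and a coset of \<open>A\<close> which
  is killed by \<open>n/b\<close>. For a prime power \<open>n = p^a\<close> the lattices \<open>A\<close> are \<open>p^i\<close> times the
  preimage of a line over \<open>\<int>/p^j\<close>, that is, of a point of the projective line over \<open>\<int>/p^j\<close>, with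
  \<open>i + j \<le> a\<close>. This gives \<open>s(p^a)\<close> as an explicit finite sum
  (\<open>subgroup_count_prime_power\<close>), and comparing second differences in \<open>a\<close> shows
  that it is the convolution of \<open>(e + 1) p^(2e)\<close> with \<open>h(p^k) = 3k(p + 1) + 1 - p\<close> for \<open>k \<ge> 1\<close>; the
  generating function of these values is \<open>(1 + 2(p + 1)X + pX\<^sup>2) / (1 - X)\<^sup>2\<close>. Consequently
  \<open>0 \<le> h(n) \<le> n \<tau>(n)\<^sup>2\<close>, and the required convergence follows.
\<close>

section \<open>Lattices between \<open>nM\<close> and \<open>M\<close>\<close>

lemma int_ideal_principal:
  fixes I :: "int set"
  assumes "0 \<in> I" "\<And>x y. x \<in> I \<Longrightarrow> y \<in> I \<Longrightarrow> x + y \<in> I" "\<And>c x. x \<in> I \<Longrightarrow> c * x \<in> I"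
    and n: "n \<in> I" "n > 0"
  shows "\<exists>b>0. b dvd n \<and> I = {x. b dvd x}"
proof -
  define b where "b = (LEAST m::nat. m > 0 \<and> int m \<in> I)"
  have b: "b > 0 \<and> int b \<in> I"
    unfolding b_def by (rule LeastI[of _ "nat n"]) (use n in auto)
  have "int b dvd x" if "x \<in> I" for x
  proof -
    have "x + (- (x div int b)) * int b \<in> I" using that b assms by blast
    hence "x mod int b \<in> I" by (simp add: minus_div_mult_eq_mod)
    moreover have "x mod int b \<ge> 0" "x mod int b < int b" using b by auto
    ultimately have "\<not> x mod int b > 0"
      using not_less_Least[of "nat (x mod int b)" "\<lambda>m. m > 0 \<and> int m \<in> I"] by (auto simp: b_def[symmetric])
    with \<open>x mod int b \<ge> 0\<close> show ?thesis by (simp add: dvd_eq_mod_eq_0)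
  qed
  moreover have "x \<in> I" if "int b dvd x" for x
    using that b assms(3)[of "int b"] by (auto simp: mult.commute)
  ultimately have "I = {x. int b dvd x}" by blast
  with b n show ?thesis by (intro exI[of _ "int b"]) auto
qed

locale zmodule = Modules.module scale for scale :: "int \<Rightarrow> 'b::ab_group_add \<Rightarrow> 'b"
begin

lemma subspaceI_diff:
  assumes "0 \<in> S" and diff: "\<And>u v. u \<in> S \<Longrightarrow> v \<in> S \<Longrightarrow> u - v \<in> S"
  shows "subspace S"
proof (rule subspaceI)
  have neg: "- v \<in> S" if "v \<in> S" for v
    using diff[OF \<open>0 \<in> S\<close> that] by simp
  show add: "u + v \<in> S" if "u \<in> S" "v \<in> S" for u v
    using diff[OF that(1) neg[OF that(2)]] by simp
  show "scale c v \<in> S" if "v \<in> S" for c v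
    by (induction c rule: int_induct[where k = 0])
       (use that assms(1) add diff in \<open>auto simp: scale_left_distrib scale_left_diff_distrib\<close>)
qed (rule assms(1))

definition lattices :: "int \<Rightarrow> 'b set set" where
  "lattices n = {L. subspace L \<and> range (scale n) \<subseteq> L}"

lemma lattices_mult:
  assumes "L \<in> lattices n"
  shows "scale (n * k) v \<in> L"
proof -
  have "scale (n * k) v = scale n (scale k v)" by simp
  thus ?thesis using assms by (auto simp: lattices_def simp del: scale_scale)
qed

text \<open>
  A Chinese remainder argument: a lattice of level \<open>m * n\<close> is recovered from its enlargements \<open>L + mM\<close>
  and \<open>L + nM\<close> as their intersection, and every pair of lattices of levels \<open>m\<close> and \<open>n\<close> arises. Both
  directions rest on the Bezout decomposition \<open>v = m\<alpha>v + n\<beta>v\<close>.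
\<close>

lemma card_lattices_mult:
  assumes "coprime m n"
  shows "card (lattices (m * n)) = card (lattices m) * card (lattices n)"
proof -
  obtain \<alpha> \<beta> where bez: "\<alpha> * m + \<beta> * n = 1"
    using assms bezout_int[of m n] by auto
  define plus_mult where "plus_mult k L = {u + scale k w |u w. u \<in> L}" for k L
  have split: "v = scale (m * \<alpha>) v + scale (n * \<beta>) v" for v
    using bez by (simp add: mult.commute flip: scale_left_distrib)
  have plus_lattice: "plus_mult k L \<in> lattices k" if L: "subspace L" for k L
  proof -
    have mult: "scale k x \<in> plus_mult k L" for x
      using subspace_0[OF L] unfolding plus_mult_def by force
    moreover have "subspace (plus_mult k L)"
    proof (rule subspaceI)
      show "0 \<in> plus_mult k L" using mult[of 0] by simp
    next
      fix u v assume "u \<in> plus_mult k L" "v \<in> plus_mult k L"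
      then obtain u' w v' w' where uv: "u = u' + scale k w" "v = v' + scale k w'" "u' \<in> L" "v' \<in> L"
        by (auto simp: plus_mult_def)
      hence "u + v = (u' + v') + scale k (w + w')" by (simp add: algebra_simps)
      with uv show "u + v \<in> plus_mult k L"
        using subspace_add[OF L] unfolding plus_mult_def by blast
    next
      fix c u assume "u \<in> plus_mult k L"
      then obtain u' w where u: "u = u' + scale k w" "u' \<in> L"
        by (auto simp: plus_mult_def)
      hence "scale c u = scale c u' + scale k (scale c w)" by (simp add: scale_right_distrib mult.commute)
      with u show "scale c u \<in> plus_mult k L"
        using subspace_scale[OF L] unfolding plus_mult_def by blast
    qed
    ultimately show ?thesis by (auto simp: lattices_def)
  qed
  have inter: "M \<inter> N \<in> lattices (m * n)" if "M \<in> lattices m" "N \<in> lattices n" for M N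
    using that lattices_mult[of M m n] lattices_mult[of N n m]
    by (auto simp: lattices_def subspace_inter mult.commute)
  have recover: "plus_mult m L \<inter> plus_mult n L = L" if mn: "L \<in> lattices (m * n)" for L
  proof
    have L: "subspace L"
      using mn by (auto simp: lattices_def)
    have "u \<in> plus_mult k L" if "u \<in> L" for u k
      using that scale_zero_right[of k] unfolding plus_mult_def
      by (metis (mono_tags, lifting) add.right_neutral mem_Collect_eq)
    thus "L \<subseteq> plus_mult m L \<inter> plus_mult n L" by blast
    show "plus_mult m L \<inter> plus_mult n L \<subseteq> L"
    proof
      fix v assume v: "v \<in> plus_mult m L \<inter> plus_mult n L"
      from v obtain a w where a: "v = a + scale m w" "a \<in> L" by (auto simp: plus_mult_def)
      from v obtain b w' where b: "v = b + scale n w'" "b \<in> L" by (auto simp: plus_mult_def)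
      have "scale (m * \<alpha>) v = scale (m * \<alpha>) b + scale (m * n * \<alpha>) w'"
        by (subst b(1)) (simp add: scale_right_distrib mult_ac)
      hence "scale (m * \<alpha>) v \<in> L"
        using L mn b by (simp add: subspace_add subspace_scale lattices_mult)
      moreover have "scale (n * \<beta>) v = scale (n * \<beta>) a + scale (m * n * \<beta>) w"
        by (subst a(1)) (simp add: scale_right_distrib mult_ac)
      hence "scale (n * \<beta>) v \<in> L"
        using L mn a by (simp add: subspace_add subspace_scale lattices_mult)
      ultimately show "v \<in> L"
        by (subst split) (rule subspace_add[OF L])
    qed
  qed
  have plus_inter: "plus_mult m (M \<inter> N) = M" if MN: "M \<in> lattices m" "N \<in> lattices n"
    and split': "\<And>v. v = scale (m * \<alpha>) v + scale (n * \<beta>) v" for M N m n \<alpha> \<beta>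
  proof
    have M: "subspace M" and N: "subspace N" and mult: "range (scale m) \<subseteq> M"
      using MN by (auto simp: lattices_def)
    show "plus_mult m (M \<inter> N) \<subseteq> M"
      using mult subspace_add[OF M] by (auto simp: plus_mult_def)
    show "M \<subseteq> plus_mult m (M \<inter> N)"
    proof
      fix v assume v: "v \<in> M"
      have "scale (n * \<beta>) v \<in> M \<inter> N"
        using MN v by (simp add: lattices_mult subspace_scale[OF M])
      moreover have "v = scale (n * \<beta>) v + scale m (scale \<alpha> v)"
        by (subst split') (simp add: add.commute)
      ultimately show "v \<in> plus_mult m (M \<inter> N)"
        unfolding plus_mult_def by blast
    qed
  qed
  have "bij_betw (\<lambda>L. (plus_mult m L, plus_mult n L)) (lattices (m * n)) (lattices m \<times> lattices n)"
  proof (rule bij_betw_byWitness[where f' = "\<lambda>(M, N). M \<inter> N"])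
    show "\<forall>L\<in>lattices (m * n). (case (plus_mult m L, plus_mult n L) of (M, N) \<Rightarrow> M \<inter> N) = L"
      using recover by simp
    have "plus_mult m (M \<inter> N) = M \<and> plus_mult n (M \<inter> N) = N"
      if MN: "M \<in> lattices m" "N \<in> lattices n" for M N
    proof -
      have "plus_mult n (N \<inter> M) = N"
        by (rule plus_inter[OF MN(2,1), of \<beta> \<alpha>]) (subst add.commute, rule split)
      thus ?thesis using plus_inter[OF MN split] by (simp add: Int_commute)
    qed
    thus "\<forall>z\<in>lattices m \<times> lattices n.
            (plus_mult m (case z of (M, N) \<Rightarrow> M \<inter> N), plus_mult n (case z of (M, N) \<Rightarrow> M \<inter> N)) = z"
      by auto
    show "(\<lambda>L. (plus_mult m L, plus_mult n L)) ` lattices (m * n) \<subseteq> lattices m \<times> lattices n"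
      using plus_lattice by (auto simp: lattices_def[of "m * n"])
    show "(\<lambda>(M, N). M \<inter> N) ` (lattices m \<times> lattices n) \<subseteq> lattices (m * n)"
      using inter by auto
  qed
  from bij_betw_same_card[OF this] show ?thesis by (simp add: card_cartesian_product)
qed

definition scale_prod :: "int \<Rightarrow> int \<times> 'b \<Rightarrow> int \<times> 'b" where
  "scale_prod k v = (k * fst v, scale k (snd v))"

lemma zmodule_scale_prod: "zmodule scale_prod"
  by unfold_locales (auto simp: scale_prod_def algebra_simps scale_right_distrib scale_left_distrib)

text \<open>
  These are the elements of order dividing \<open>k\<close> in the quotient module by \<open>A\<close>, each one as a coset of \<open>A\<close>.
\<close>

definition cosets :: "'b set \<Rightarrow> int \<Rightarrow> 'b set set" where
  "cosets A k = (\<lambda>v. {w. w - v \<in> A}) ` {v. scale k v \<in> A}"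

text \<open>
  The analogue of Goursat's lemma for \<open>\<int> \<times> M\<close>. Given a lattice, \<open>A\<close> is its fibre over \<open>0\<close>, \<open>b\<close> generates
  the ideal of its first coordinates, and \<open>C\<close> is its fibre over \<open>b\<close>, a coset of \<open>A\<close>. The level \<open>n\<close> forces
  \<open>b\<close> to divide \<open>n\<close> and, since \<open>(n, 0)\<close> is in the lattice, \<open>n div b\<close> to kill the coset.
\<close>

lemma bij_betw_lattices_prod:
  assumes n: "n > 0"
  shows "bij_betw (\<lambda>(A, b, C). {(x, w). b dvd x \<and> (\<exists>v\<in>C. w - scale (x div b) v \<in> A)})
           (SIGMA A:lattices n. SIGMA b:{b. 0 < b \<and> b dvd n}. cosets A (n div b))
           (zmodule.lattices scale_prod n)"
proof -
  interpret P: zmodule scale_prod by (rule zmodule_scale_prod)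
  define F where "F = (\<lambda>(A, b, C). {(x, w). b dvd x \<and> (\<exists>v\<in>C. w - scale (x div b) v \<in> A)})"
  define X where "X = (SIGMA A:lattices n. SIGMA b:{b. 0 < b \<and> b dvd n}. cosets A (n div b))"
  \<comment> \<open>Membership in the image lattice can be tested on any representative of the coset.\<close>
  have F_coset: "F (A, b, {w. w - v \<in> A}) = {(x, w). b dvd x \<and> w - scale (x div b) v \<in> A}"
    if A: "subspace A" for A b v
  proof -
    have "w - scale k v \<in> A" if "w - scale k v' \<in> A" "v' - v \<in> A" for w k v'
    proof -
      have "w - scale k v = (w - scale k v') + scale k (v' - v)" by (simp add: algebra_simps)
      thus ?thesis using that A by (metis subspace_add subspace_scale)
    qed
    moreover have "v - v \<in> A" using A by (simp add: subspace_0)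
    ultimately have "(\<exists>v'\<in>{w. w - v \<in> A}. w - scale k v' \<in> A) \<longleftrightarrow> w - scale k v \<in> A" for w k
      by blast
    thus ?thesis by (simp add: F_def)
  qed
  have inj: "inj_on F X"
  proof (rule inj_onI)
    fix z z' assume z: "z \<in> X" "z' \<in> X" "F z = F z'"
    obtain A b v where z1: "z = (A, b, {w. w - v \<in> A})" "A \<in> lattices n" "b > 0"
      using z(1) by (auto simp: X_def cosets_def)
    obtain A' b' v' where z2: "z' = (A', b', {w. w - v' \<in> A'})" "A' \<in> lattices n" "b' > 0"
      using z(2) by (auto simp: X_def cosets_def)
    have A: "subspace A" "subspace A'" using z1 z2 by (auto simp: lattices_def)
    have eq: "b dvd x \<and> w - scale (x div b) v \<in> A \<longleftrightarrow> b' dvd x \<and> w - scale (x div b') v' \<in> A'" for x w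
      using z(3) F_coset[OF A(1)] F_coset[OF A(2)] unfolding z1 z2 by auto
    have "A = A'" using eq[of 0] by auto
    have "b' dvd b" using eq[of b v] A z1 by (simp add: subspace_0)
    moreover have "b dvd b'" using eq[of b' v'] A z2 by (simp add: subspace_0)
    ultimately have "b = b'" using z1 z2 by (simp add: zdvd_antisym_nonneg)
    have "w - v \<in> A \<longleftrightarrow> w - v' \<in> A'" for w
      using eq[of b w] \<open>b = b'\<close> z1 by simp
    with \<open>A = A'\<close> \<open>b = b'\<close> show "z = z'" unfolding z1 z2 by simp
  qed
  have F_lattice: "F z \<in> P.lattices n" if z: "z \<in> X" for z
  proof -
    obtain A b v where z1: "z = (A, b, {w. w - v \<in> A})" "A \<in> lattices n" "b > 0" "b dvd n"
        "scale (n div b) v \<in> A"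
      using z(1) by (auto simp: X_def cosets_def)
    have A: "subspace A" using z1 by (auto simp: lattices_def)
    have Fz: "F z = {(x, w). b dvd x \<and> w - scale (x div b) v \<in> A}"
      unfolding z1 by (rule F_coset[OF A])
    have "P.subspace (F z)"
    proof (rule P.subspaceI)
      show "0 \<in> F z" using A by (auto simp: Fz zero_prod_def subspace_0)
    next
      fix u u' assume u: "u \<in> F z" "u' \<in> F z"
      obtain x w x' w' where uu: "u = (b * x, w)" "u' = (b * x', w')"
        "w - scale x v \<in> A" "w' - scale x' v \<in> A"
        using u z1(3) unfolding Fz by (auto elim!: dvdE)
      have "w + w' - scale (x + x') v = (w - scale x v) + (w' - scale x' v)"
        by (simp add: algebra_simps)
      hence "w + w' - scale (x + x') v \<in> A" using uu A by (metis subspace_add)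
      moreover have "(b * x + b * x') div b = x + x'" using z1(3) by (simp flip: distrib_left)
      ultimately show "u + u' \<in> F z" unfolding uu Fz by simp
    next
      fix c u assume u: "u \<in> F z"
      obtain x w where uu: "u = (b * x, w)" "w - scale x v \<in> A"
        using u z1(3) unfolding Fz by (auto elim!: dvdE)
      have "scale c w - scale (c * x) v = scale c (w - scale x v)"
        by (simp add: scale_right_diff_distrib)
      hence "scale c w - scale (c * x) v \<in> A" using uu A by (metis subspace_scale)
      moreover have "c * (b * x) div b = c * x" using z1(3) by (simp add: mult.left_commute)
      ultimately show "scale_prod c u \<in> F z" unfolding uu Fz by (simp add: scale_prod_def)
    qed
    moreover have "scale_prod n (x, w) \<in> F z" for x w
    proof -
      have "scale n w \<in> A" using z1 by (auto simp: lattices_def)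
      moreover have "scale (n * x div b) v = scale x (scale (n div b) v)"
        using z1(4) by (simp add: div_mult_swap mult.commute)
      ultimately have "scale n w - scale (n * x div b) v \<in> A"
        using z1(5) A by (simp add: subspace_diff subspace_scale del: scale_scale)
      thus ?thesis using z1(4) by (simp add: Fz scale_prod_def)
    qed
    ultimately show ?thesis by (auto simp: P.lattices_def)
  qed
  have surj: "L \<in> F ` X" if L: "L \<in> P.lattices n" for L
  proof -
    have sub: "P.subspace L" using L by (simp add: P.lattices_def)
    have add: "(x + x', w + w') \<in> L" if "(x, w) \<in> L" "(x', w') \<in> L" for x x' w w'
      using P.subspace_add[OF sub that] by simp
    have diff: "(x - x', w - w') \<in> L" if "(x, w) \<in> L" "(x', w') \<in> L" for x x' w w'
      using P.subspace_diff[OF sub that] by simp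
    have mult: "(c * x, scale c w) \<in> L" if "(x, w) \<in> L" for c x w
      using P.subspace_scale[OF sub that] by (simp add: scale_prod_def)
    have zero: "(0, 0) \<in> L" using P.subspace_0[OF sub] by (simp add: zero_prod_def)
    have nL: "(n * x, scale n w) \<in> L" for x w
    proof -
      have "scale_prod n (x, w) \<in> L" using L by (auto simp: P.lattices_def)
      thus ?thesis by (simp add: scale_prod_def)
    qed
    define A where "A = {w. (0, w) \<in> L}"
    have A: "subspace A"
      using zero add[of 0 _ 0] mult[of 0] by (intro subspaceI) (auto simp: A_def)
    have An: "A \<in> lattices n" using A nL[of 0] by (auto simp: lattices_def A_def)
    have "\<exists>b>0. b dvd n \<and> {x. \<exists>w. (x, w) \<in> L} = {x. b dvd x}"
    proof (rule int_ideal_principal)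
      show "n \<in> {x. \<exists>w. (x, w) \<in> L}" using nL[of 1] by auto
    qed (use zero add mult n in \<open>blast+\<close>)
    then obtain b where b: "b > 0" "b dvd n" "\<And>x. (\<exists>w. (x, w) \<in> L) \<longleftrightarrow> b dvd x" by auto
    obtain v where v: "(b, v) \<in> L" using b(3)[of b] by auto
    have "(n, scale (n div b) v) \<in> L" using mult[OF v, of "n div b"] b by simp
    moreover have "(n, 0) \<in> L" using nL[of 1 0] by simp
    ultimately have "scale (n div b) v \<in> A" using diff[of n _ n 0] by (simp add: A_def)
    hence "(A, b, {w. w - v \<in> A}) \<in> X" using An b by (auto simp: X_def cosets_def)
    moreover have "F (A, b, {w. w - v \<in> A}) = L"
    proof -
      have "(x, w) \<in> L \<longleftrightarrow> b dvd x \<and> w - scale (x div b) v \<in> A" for x w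
      proof (cases "b dvd x")
        case True
        hence xv: "(x, scale (x div b) v) \<in> L" using mult[OF v, of "x div b"] by simp
        show ?thesis
          using True diff[OF _ xv, of x w] add[OF xv, of 0 "w - scale (x div b) v"]
          by (auto simp: A_def)
      qed (use b(3) in auto)
      thus ?thesis unfolding F_coset[OF A] by auto
    qed
    ultimately show ?thesis by (metis imageI)
  qed
  have "bij_betw F X (P.lattices n)"
    unfolding bij_betw_def using inj F_lattice surj by blast
  thus ?thesis unfolding F_def X_def .
qed

end

section \<open>Subgroups of \<open>\<int>\<^sub>n\<^sup>3\<close> as lattices\<close>

definition scale2 :: "int \<Rightarrow> int \<times> int \<Rightarrow> int \<times> int" where
  "scale2 k v = (k * fst v, k * snd v)"

interpretation Z2: zmodule scale2
  by unfold_locales (auto simp: scale2_def algebra_simps)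

definition scale3 :: "int \<Rightarrow> int \<times> int \<times> int \<Rightarrow> int \<times> int \<times> int" where
  "scale3 = Z2.scale_prod"

interpretation Z3: zmodule scale3
  unfolding scale3_def by (rule Z2.zmodule_scale_prod)

lemma scale3_eq: "scale3 k (x, y, z) = (k * x, k * y, k * z)"
  by (simp add: scale3_def Z2.scale_prod_def scale2_def)

text \<open>
  The correspondence theorem for the reduction map from \<open>\<int>\<^sup>3\<close> to \<open>\<int>\<^sub>n\<^sup>3\<close>, written out for the
  representatives \<open>{0..<n}\<close> that form the carrier of \<^const>\<open>integer_mod_group\<close>.
\<close>

lemma subgroup_count_eq_card_lattices:
  assumes "n > 0"
  shows "subgroup_count n = card (Z3.lattices (int n))"
proof -
  define G where "G = integer_mod_group n \<times>\<times> integer_mod_group n \<times>\<times> integer_mod_group n"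
  define B where "B = {0..<int n} \<times> {0..<int n} \<times> {0..<int n}"
  define red :: "int \<times> int \<times> int \<Rightarrow> int \<times> int \<times> int" where
    "red = (\<lambda>(x, y, z). (x mod int n, y mod int n, z mod int n))"
  have G: "group G"
    unfolding G_def by (intro DirProd_group group_integer_mod_group)
  have carrier: "carrier G = B"
    using assms by (simp add: G_def B_def carrier_integer_mod_group)
  have one: "\<one>\<^bsub>G\<^esub> = 0"
    by (simp add: G_def zero_prod_def)
  have mult: "u \<otimes>\<^bsub>G\<^esub> v = red (u + v)" for u v
    by (cases u, cases v) (simp add: G_def red_def)
  have red_in: "red v \<in> B" for v
    using assms by (cases v) (auto simp: B_def red_def)
  have red_id: "red v = v" if "v \<in> B" for v
    using that by (auto simp: B_def red_def)
  have inv: "inv\<^bsub>G\<^esub> v = red (- v)" if "v \<in> B" for v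
  proof (rule group.inv_equality[OF G])
    show "red (- v) \<otimes>\<^bsub>G\<^esub> v = \<one>\<^bsub>G\<^esub>"
      by (cases v) (simp add: mult one red_def zero_prod_def mod_simps)
  qed (use that red_in carrier in auto)
  have red_diff: "red (u - v) = red u \<otimes>\<^bsub>G\<^esub> inv\<^bsub>G\<^esub> (red v)" for u v
    by (cases u, cases v) (simp add: mult inv[OF red_in], simp add: red_def mod_simps)
  have red_scale: "\<exists>w. red v = v - scale3 (int n) w" for v
    by (cases v) (auto simp: red_def scale3_eq minus_mult_div_eq_mod[symmetric])
  have red_scale': "red (u + scale3 (int n) w) = red u" for u w
    by (cases u, cases w) (auto simp: red_def scale3_eq)
  have red_L: "red v \<in> L \<longleftrightarrow> v \<in> L" if L: "L \<in> Z3.lattices (int n)" for L v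
  proof -
    obtain w where w: "red v = v - scale3 (int n) w" using red_scale by blast
    have "scale3 (int n) w \<in> L" "Z3.subspace L" using L by (auto simp: Z3.lattices_def)
    thus ?thesis
      using Z3.subspace_diff[of L v "scale3 (int n) w"]
            Z3.subspace_add[of L "red v" "scale3 (int n) w"] w by auto
  qed
  have "bij_betw (\<lambda>K. {v. red v \<in> K}) {K. subgroup K G} (Z3.lattices (int n))"
  proof (rule bij_betw_byWitness[where f' = "\<lambda>L. L \<inter> B"])
    show "\<forall>K\<in>{K. subgroup K G}. {v. red v \<in> K} \<inter> B = K"
    proof safe
      fix K v assume K: "subgroup K G" and v: "v \<in> K"
      from subgroup.subset[OF K] v show "v \<in> B" by (auto simp: carrier)
      with v show "red v \<in> K" by (simp add: red_id)
    qed (use red_id in auto)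
    show "\<forall>L\<in>Z3.lattices (int n). {v. red v \<in> L \<inter> B} = L"
      using red_L red_in by auto
    show "(\<lambda>K. {v. red v \<in> K}) ` {K. subgroup K G} \<subseteq> Z3.lattices (int n)"
    proof safe
      fix K assume K: "subgroup K G"
      have "red 0 = \<one>\<^bsub>G\<^esub>" using assms by (simp add: one red_def zero_prod_def)
      hence "red 0 \<in> K" using subgroup.one_closed[OF K] by simp
      moreover have "red (u - v) \<in> K" if "red u \<in> K" "red v \<in> K" for u v
        unfolding red_diff using that K by (simp add: subgroup.m_closed subgroup.m_inv_closed)
      moreover have "red (scale3 (int n) w) = red 0" for w
        using red_scale'[of 0 w] by simp
      ultimately show "{v. red v \<in> K} \<in> Z3.lattices (int n)"
        by (auto simp: Z3.lattices_def intro!: Z3.subspaceI_diff)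
    qed
    show "(\<lambda>L. L \<inter> B) ` Z3.lattices (int n) \<subseteq> {K. subgroup K G}"
    proof safe
      fix L assume L: "L \<in> Z3.lattices (int n)"
      hence L': "Z3.subspace L" by (simp add: Z3.lattices_def)
      show "subgroup (L \<inter> B) G"
      proof (rule group.subgroupI[OF G])
        have "0 \<in> B" using assms by (simp add: B_def zero_prod_def)
        thus "L \<inter> B \<noteq> {}" using Z3.subspace_0[OF L'] by auto
      qed (use red_L[OF L] red_in L' in
        \<open>auto simp: carrier inv mult Z3.subspace_add Z3.subspace_neg\<close>)
    qed
  qed
  hence "card {K. subgroup K G} = card (Z3.lattices (int n))"
    by (rule bij_betw_same_card)
  thus ?thesis by (simp add: subgroup_count_def G_def)
qed

section \<open>Plane lattices of prime power level\<close>

text \<open>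
  This is \<open>p^i\<close> times the lattice of those \<open>(x, y)\<close> that lie modulo \<open>p^j\<close> on the line spanned by \<open>(t, 1)\<close>;
  the divisibility of \<open>x\<close> by \<open>p^i\<close> follows from the two conditions. The quotient of \<open>\<int>\<^sup>2\<close> by it is
  isomorphic to \<open>\<int>/p^(i+j) \<times> \<int>/p^i\<close>.
\<close>

definition line_lattice :: "int \<Rightarrow> nat \<Rightarrow> nat \<Rightarrow> int \<Rightarrow> (int \<times> int) set" where
  "line_lattice p i j t = {(x, y). p ^ i dvd y \<and> p ^ (i + j) dvd x - t * y}"

text \<open>
  The points of the projective line over \<open>\<int>/p^j\<close>: \<open>(False, t)\<close> stands for \<open>(t : 1)\<close> and \<open>(True, t)\<close>, with \<open>t\<close>
  divisible by \<open>p\<close>, for \<open>(1 : t)\<close>. For \<open>j = 0\<close> there is exactly one point.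
\<close>

definition proj_points :: "int \<Rightarrow> nat \<Rightarrow> (bool \<times> int) set" where
  "proj_points p j = {False} \<times> {0..<p ^ j} \<union>
     (if j = 0 then {} else {True} \<times> {t\<in>{0..<p ^ j}. p dvd t})"

definition point_lattice :: "int \<Rightarrow> nat \<times> nat \<times> bool \<times> int \<Rightarrow> (int \<times> int) set" where
  "point_lattice p = (\<lambda>(i, j, s, t). (if s then prod.swap else id) ` line_lattice p i j t)"

definition plane_types :: "nat \<Rightarrow> (nat \<times> nat) set" where
  "plane_types a = {(i, j). i + j \<le> a}"

lemma int_power_dvd_iff: "p > 1 \<Longrightarrow> (p::int) ^ m dvd p ^ n \<longleftrightarrow> m \<le> n"
  by (subst dvd_power_iff) auto

lemma finite_plane_types: "finite (plane_types a)"
  by (rule finite_subset[of _ "{..a} \<times> {..a}"]) (auto simp: plane_types_def)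

lemma card_multiples_below:
  fixes d :: int
  assumes "d > 0" "m \<ge> 0"
  shows "card {t\<in>{0..<d * m}. d dvd t} = nat m"
proof -
  have "{t\<in>{0..<d * m}. d dvd t} = (\<lambda>u. d * u) ` {0..<m}"
    using assms by (auto elim!: dvdE simp: zero_le_mult_iff image_iff)
  moreover have "inj_on (\<lambda>u. d * u) {0..<m}" using assms by (auto simp: inj_on_def)
  ultimately show ?thesis by (simp add: card_image)
qed

lemma finite_proj_points: "finite (proj_points p j)"
proof -
  have "{t\<in>{0..<p ^ j}. p dvd t} \<subseteq> {0..<p ^ j}" by auto
  hence "finite {t\<in>{0..<p ^ j}. p dvd t}" by (rule finite_subset) simp
  thus ?thesis by (simp add: proj_points_def)
qed

lemma card_proj_points:
  assumes "p > 0"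
  shows "card (proj_points p j) = (if j = 0 then 1 else nat p ^ j + nat p ^ (j - 1))"
proof (cases j)
  case (Suc k)
  define T where "T = {t\<in>{0..<p ^ j}. p dvd t}"
  have "card {t\<in>{0..<p * p ^ k}. p dvd t} = nat (p ^ k)"
    using assms by (intro card_multiples_below) auto
  hence T: "card T = nat p ^ (j - 1)" using Suc assms by (simp add: T_def nat_power_eq)
  have fin: "finite T" by (rule finite_subset[of _ "{0..<p ^ j}"]) (auto simp: T_def)
  have "proj_points p j = {False} \<times> {0..<p ^ j} \<union> {True} \<times> T"
    using Suc by (simp add: proj_points_def T_def)
  also have "card \<dots> = card ({False} \<times> {0..<p ^ j}) + card ({True} \<times> T)"
    by (rule card_Un_disjoint) (use fin in auto)
  finally show ?thesis
    using Suc assms T by (simp add: card_cartesian_product nat_power_eq nat_mult_distrib)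
qed (simp add: proj_points_def)

lemma line_lattice_in_lattices:
  assumes "i + j \<le> a"
  shows "line_lattice p i j t \<in> Z2.lattices (p ^ a)"
proof -
  have "Z2.subspace (line_lattice p i j t)"
  proof (rule Z2.subspaceI_diff)
    show "0 \<in> line_lattice p i j t" by (simp add: line_lattice_def zero_prod_def)
  next
    fix u v assume "u \<in> line_lattice p i j t" "v \<in> line_lattice p i j t"
    then obtain x y x' y' where uv: "u = (x, y)" "v = (x', y')" "p ^ i dvd y" "p ^ i dvd y'"
      "p ^ (i + j) dvd x - t * y" "p ^ (i + j) dvd x' - t * y'"
      by (auto simp: line_lattice_def)
    have "x - x' - t * (y - y') = (x - t * y) - (x' - t * y')" by (simp add: algebra_simps)
    hence "p ^ (i + j) dvd x - x' - t * (y - y')" using uv(5,6) by (metis dvd_diff)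
    with uv show "u - v \<in> line_lattice p i j t" by (simp add: line_lattice_def)
  qed
  moreover have "p ^ i dvd p ^ a" "p ^ (i + j) dvd p ^ a"
    using assms by (auto intro!: le_imp_power_dvd)
  hence "range (scale2 (p ^ a)) \<subseteq> line_lattice p i j t"
    by (auto simp: line_lattice_def scale2_def intro!: dvd_diff)
  ultimately show ?thesis by (simp add: Z2.lattices_def)
qed

lemma swap_in_lattices:
  assumes "L \<in> Z2.lattices n"
  shows "prod.swap ` L \<in> Z2.lattices n"
proof -
  have L: "Z2.subspace L" "range (scale2 n) \<subseteq> L" using assms by (auto simp: Z2.lattices_def)
  have "Z2.subspace (prod.swap ` L)"
  proof (rule Z2.subspaceI_diff)
    show "0 \<in> prod.swap ` L"
      using Z2.subspace_0[OF L(1)] by (force simp: zero_prod_def)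
    fix u v assume "u \<in> prod.swap ` L" "v \<in> prod.swap ` L"
    then obtain u' v' where "u = prod.swap u'" "v = prod.swap v'" "u' \<in> L" "v' \<in> L" by auto
    moreover have "prod.swap u' - prod.swap v' = prod.swap (u' - v')" by (simp add: prod_eq_iff)
    ultimately show "u - v \<in> prod.swap ` L" using Z2.subspace_diff[OF L(1)] by simp
  qed
  moreover have "scale2 n v = prod.swap (scale2 n (prod.swap v))" for v
    by (simp add: scale2_def)
  hence "range (scale2 n) \<subseteq> prod.swap ` L" using L(2) by blast
  ultimately show ?thesis by (simp add: Z2.lattices_def)
qed

lemma line_lattice_eqD:
  fixes p :: int
  assumes "p > 1" and eq: "line_lattice p i j t = line_lattice p i' j' t'"
    and t: "t \<in> {0..<p ^ j}" "t' \<in> {0..<p ^ j'}"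
  shows "i = i' \<and> j = j' \<and> t = t'"
proof -
  have gen: "(p ^ i * t, p ^ i) \<in> line_lattice p i j t" "(p ^ (i + j), 0) \<in> line_lattice p i j t"
    for i j :: nat and t :: int
    by (auto simp: line_lattice_def)
  have mem: "(p ^ i * t, p ^ i) \<in> line_lattice p i' j' t'" "(p ^ (i + j), 0) \<in> line_lattice p i' j' t'"
    using gen[where i = i and j = j and t = t] unfolding eq by simp_all
  have mem': "(p ^ i' * t', p ^ i') \<in> line_lattice p i j t" "(p ^ (i' + j'), 0) \<in> line_lattice p i j t"
    using gen[where i = i' and j = j' and t = t'] unfolding eq by simp_all
  have "p ^ i' dvd p ^ i" "p ^ i dvd p ^ i'" "p ^ (i' + j') dvd p ^ (i + j)" "p ^ (i + j) dvd p ^ (i' + j')"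
    using mem mem' by (auto simp: line_lattice_def)
  hence "i = i'" "i + j = i' + j'"
    using assms(1) by (auto simp: int_power_dvd_iff intro: order.antisym)
  hence ij: "i = i'" "j = j'" by auto
  have "p ^ (i + j) dvd p ^ i * t - t' * p ^ i"
    using mem(1) by (simp add: line_lattice_def ij)
  hence "p ^ i * p ^ j dvd p ^ i * (t - t')" by (simp add: power_add algebra_simps)
  hence "p ^ j dvd t - t'" using assms(1) by simp
  hence "t mod p ^ j = t' mod p ^ j" by (simp add: mod_eq_dvd_iff)
  with t ij show ?thesis by simp
qed

text \<open>
  If the two lattices were equal, then the generators of each, tested in the other, would give
  \<open>i' + j' \<le> i\<close> and \<open>i + j \<le> i'\<close>, because \<open>1 - t * t'\<close> is a unit modulo \<open>p\<close>. This is impossible for \<open>j' > 0\<close>.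
\<close>

lemma line_lattice_neq_swap:
  fixes p :: int
  assumes p: "prime p" and "j' > 0" "p dvd t'"
  shows "line_lattice p i j t \<noteq> prod.swap ` line_lattice p i' j' t'"
proof
  assume eq: "line_lattice p i j t = prod.swap ` line_lattice p i' j' t'"
  have p1: "p > 1" using p by (rule prime_gt_1_int)
  have swap: "prod.swap ` line_lattice p i' j' t' = {(x, y). p ^ i' dvd x \<and> p ^ (i' + j') dvd y - t' * x}"
    by (force simp: line_lattice_def)
  have unit: "coprime (p ^ m) (1 - t * t')" for m
  proof -
    have "\<not> p dvd 1 - t * t'"
      using \<open>p dvd t'\<close> not_prime_unit[of p] p
      by (metis dvd_add_left_iff dvd_mult diff_add_cancel)
    thus ?thesis using p by (simp add: prime_imp_coprime)
  qed
  have "(p ^ i * t, p ^ i) \<in> line_lattice p i j t" by (auto simp: line_lattice_def)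
  hence "p ^ (i' + j') dvd p ^ i - t' * (p ^ i * t)"
    unfolding eq swap by simp
  also have "p ^ i - t' * (p ^ i * t) = p ^ i * (1 - t * t')" by (simp add: algebra_simps)
  finally have "p ^ (i' + j') dvd p ^ i" by (subst (asm) coprime_dvd_mult_left_iff[OF unit])
  hence "i' + j' \<le> i" using p1 by (simp add: int_power_dvd_iff)
  have "(p ^ i', p ^ i' * t') \<in> line_lattice p i j t" unfolding eq swap by auto
  hence "p ^ (i + j) dvd p ^ i' - t * (p ^ i' * t')" by (simp add: line_lattice_def)
  also have "p ^ i' - t * (p ^ i' * t') = p ^ i' * (1 - t * t')" by (simp add: algebra_simps)
  finally have "p ^ (i + j) dvd p ^ i'" by (subst (asm) coprime_dvd_mult_left_iff[OF unit])
  hence "i + j \<le> i'" using p1 by (simp add: int_power_dvd_iff)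
  with \<open>i' + j' \<le> i\<close> \<open>j' > 0\<close> show False by simp
qed

text \<open>
  Here \<open>p^i\<close> is the largest power of \<open>p\<close> dividing the whole lattice. Some vector then has a coordinate that
  is a unit after division by \<open>p^i\<close>, and when this is the second coordinate the vector can be normalised to
  \<open>p^i * (t, 1)\<close>. Subtracting multiples of it reduces the lattice to its intersection with the first axis,
  which is an ideal containing \<open>p^a\<close> and so generated by some \<open>p^(i+j)\<close>.
\<close>

lemma eq_line_lattice:
  fixes p :: int
  assumes p: "prime p" and A: "A \<in> Z2.lattices (p ^ a)"
    and div: "\<And>x y. (x, y) \<in> A \<Longrightarrow> p ^ i dvd x \<and> p ^ i dvd y"
    and v: "(p ^ i * u, p ^ i * v) \<in> A" "\<not> p dvd v"
  shows "\<exists>j t. i + j \<le> a \<and> t \<in> {0..<p ^ j} \<and> A = line_lattice p i j t"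
proof -
  have p1: "p > 1" using p by (rule prime_gt_1_int)
  have sub: "Z2.subspace A" using A by (simp add: Z2.lattices_def)
  have add: "(x + x', y + y') \<in> A" if "(x, y) \<in> A" "(x', y') \<in> A" for x x' y y'
    using Z2.subspace_add[OF sub that] by simp
  have diff: "(x - x', y - y') \<in> A" if "(x, y) \<in> A" "(x', y') \<in> A" for x x' y y'
    using Z2.subspace_diff[OF sub that] by simp
  have mult: "(c * x, c * y) \<in> A" if "(x, y) \<in> A" for c x y
    using Z2.subspace_scale[OF sub that, of c] by (simp add: scale2_def)
  have pa: "(p ^ a * x, p ^ a * y) \<in> A" for x y
  proof -
    have "scale2 (p ^ a) (x, y) \<in> A" using A by (auto simp: Z2.lattices_def)
    thus ?thesis by (simp add: scale2_def)
  qed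
  have "p ^ i dvd p ^ a" using div[OF pa[of 1 0]] by simp
  hence ia: "i \<le> a" using p1 by (simp add: int_power_dvd_iff)
  have "coprime v (p ^ a)"
    using p v(2) prime_imp_coprime[of p v] by (simp add: coprime_commute)
  \<comment> \<open>The inverse is only needed modulo \<open>p^a\<close>, as the lattice contains all multiples of \<open>p^a\<close>.\<close>
  then obtain s where s: "[v * s = 1] (mod p ^ a)"
    using cong_solve_coprime_int by blast
  then obtain c where c: "v * s = 1 + p ^ a * c"
    by (metis cong_iff_lin cong_sym)
  define t0 where "t0 = s * u"
  have gen: "(p ^ i * t0, p ^ i) \<in> A"
  proof -
    have "(s * (p ^ i * u) - p ^ a * 0, s * (p ^ i * v) - p ^ a * (p ^ i * c)) \<in> A"
      by (intro diff mult pa v)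
    also have "s * (p ^ i * v) - p ^ a * (p ^ i * c) = p ^ i * (v * s - p ^ a * c)"
      by (simp add: algebra_simps)
    also have "v * s - p ^ a * c = 1" using c by simp
    finally show ?thesis by (simp add: t0_def mult_ac)
  qed
  define J where "J = {x. (p ^ i * x, 0) \<in> A}"
  have "\<exists>b>0. b dvd p ^ (a - i) \<and> J = {x. b dvd x}"
  proof (rule int_ideal_principal)
    show "0 \<in> J" using Z2.subspace_0[OF sub] by (simp add: J_def zero_prod_def)
    show "x + y \<in> J" if "x \<in> J" "y \<in> J" for x y
      using that add[of "p ^ i * x" 0 "p ^ i * y" 0] by (simp add: J_def distrib_left)
    show "c * x \<in> J" if "x \<in> J" for c x
      using that mult[of "p ^ i * x" 0 c] by (simp add: J_def mult.left_commute)
    show "p ^ (a - i) \<in> J"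
      using pa[of 1 0] ia by (simp add: J_def flip: power_add)
  qed (use p1 in auto)
  then obtain b where b: "b > 0" "b dvd p ^ (a - i)" "\<And>x. (p ^ i * x, 0) \<in> A \<longleftrightarrow> b dvd x"
    by (auto simp: J_def)
  obtain j where j: "j \<le> a - i" "b = p ^ j"
    using divides_primepow[OF p b(2)] b(1) by auto
  define t where "t = t0 mod p ^ j"
  have "(x, y) \<in> A \<longleftrightarrow> p ^ i dvd y \<and> p ^ (i + j) dvd x - t * y" for x y
  proof (cases "p ^ i dvd y")
    case True
    then obtain y' where y: "y = p ^ i * y'" by blast
    have "p ^ (i + j) dvd (t0 - t) * y"
      by (simp add: y t_def power_add minus_mod_eq_mult_div mult_ac)
    hence eq: "p ^ (i + j) dvd x - t * y \<longleftrightarrow> p ^ (i + j) dvd x - t0 * y"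
    proof -
      have "x - t * y = (x - t0 * y) + (t0 - t) * y" by (simp add: algebra_simps)
      thus ?thesis using dvd_add_left_iff[OF \<open>p ^ (i + j) dvd (t0 - t) * y\<close>] by metis
    qed
    have g: "(t0 * y, y) \<in> A" using mult[OF gen, of y'] by (simp add: y mult_ac)
    have "(x, y) \<in> A \<longleftrightarrow> (x - t0 * y, 0) \<in> A"
      using diff[OF _ g, of x y] add[OF _ g, of "x - t0 * y" 0] by auto
    also have "\<dots> \<longleftrightarrow> p ^ (i + j) dvd x - t0 * y"
    proof
      assume *: "(x - t0 * y, 0) \<in> A"
      then obtain z where z: "x - t0 * y = p ^ i * z" using div by blast
      thus "p ^ (i + j) dvd x - t0 * y" using * b(3)[of z] j by (simp add: power_add)
    next
      assume "p ^ (i + j) dvd x - t0 * y"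
      then obtain z where z: "x - t0 * y = p ^ i * (p ^ j * z)" unfolding power_add dvd_def mult.assoc by blast
      thus "(x - t0 * y, 0) \<in> A" using b(3)[of "p ^ j * z"] j by simp
    qed
    finally show ?thesis using True eq by simp
  qed (use div in auto)
  hence "A = line_lattice p i j t" by (auto simp: line_lattice_def)
  moreover have "t \<in> {0..<p ^ j}" using p1 by (simp add: t_def)
  ultimately show ?thesis using j ia by (intro exI[of _ j] exI[of _ t]) auto
qed

lemma bij_betw_point_lattice:
  fixes p :: int
  assumes p: "prime p"
  shows "bij_betw (point_lattice p)
           {(i, j, z). (i, j) \<in> plane_types a \<and> z \<in> proj_points p j} (Z2.lattices (p ^ a))"
  (is "bij_betw _ ?X _")
proof -
  have p1: "p > 1" using p by (rule prime_gt_1_int)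
  have "inj_on (point_lattice p) ?X"
  proof (rule inj_onI)
    fix z z' assume *: "z \<in> ?X" "z' \<in> ?X" "point_lattice p z = point_lattice p z'"
    obtain i j s t where z: "z = (i, j, s, t)" by (metis prod_cases4)
    obtain i' j' s' t' where z': "z' = (i', j', s', t')" by (metis prod_cases4)
    define f where "f s = (if s then prod.swap else (id :: int \<times> int \<Rightarrow> _))" for s
    have eq: "f s ` line_lattice p i j t = f s' ` line_lattice p i' j' t'"
      using *(3) by (simp add: z z' point_lattice_def f_def)
    have t: "t \<in> {0..<p ^ j}" "t' \<in> {0..<p ^ j'}" "s \<Longrightarrow> j > 0 \<and> p dvd t" "s' \<Longrightarrow> j' > 0 \<and> p dvd t'"
      using *(1,2) by (auto simp: z z' proj_points_def split: if_splits)
    have "s = s'"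
      using eq t line_lattice_neq_swap[OF p, of j' t' i j t i']
        line_lattice_neq_swap[OF p, of j t i' j' t' i]
      by (cases s; cases s') (auto simp: f_def)
    moreover have "inj (f s')" by (simp add: f_def)
    ultimately have "line_lattice p i j t = line_lattice p i' j' t'"
      using eq by (simp add: inj_image_eq_iff)
    from line_lattice_eqD[OF p1 this t(1,2)] \<open>s = s'\<close> show "z = z'" by (simp add: z z')
  qed
  moreover have "point_lattice p z \<in> Z2.lattices (p ^ a)" if "z \<in> ?X" for z
    using that line_lattice_in_lattices swap_in_lattices
    by (auto simp: point_lattice_def plane_types_def)
  moreover have "A \<in> point_lattice p ` ?X" if A: "A \<in> Z2.lattices (p ^ a)" for A
  proof -
    define D where "D i \<longleftrightarrow> (\<forall>x y. (x, y) \<in> A \<longrightarrow> p ^ i dvd x \<and> p ^ i dvd y)" for i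
    have "scale2 (p ^ a) (1, 0) \<in> A" using A by (auto simp: Z2.lattices_def)
    hence pa: "(p ^ a, 0) \<in> A" by (simp add: scale2_def)
    have le: "i \<le> a" if "D i" for i
    proof -
      have "p ^ i dvd p ^ a" using that pa unfolding D_def by blast
      thus ?thesis using p1 by (simp add: int_power_dvd_iff)
    qed
    have ex: "\<exists>i. D i \<and> (\<forall>k. D k \<longrightarrow> k \<le> i)"
    proof (rule ex_has_greatest_nat[of D 0 "\<lambda>i. i" "Suc a"])
      show "D 0" by (simp add: D_def)
      show "\<forall>y. D y \<longrightarrow> y < Suc a" using le by (simp add: less_Suc_eq_le)
    qed
    then obtain i where i: "D i" "\<And>k. D k \<Longrightarrow> k \<le> i" by blast
    \<comment> \<open>By maximality of \<open>i\<close> some coordinate is not divisible by a higher power. If this never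
      happens in the second coordinate, the lattice is swapped, and then \<open>t\<close> cannot be a unit.\<close>
    have "\<not> D (Suc i)" using i(2)[of "Suc i"] by auto
    then obtain x y where xy: "(x, y) \<in> A" "\<not> (p ^ Suc i dvd x \<and> p ^ Suc i dvd y)"
      by (auto simp: D_def)
    from xy(1) i(1) have "p ^ i dvd x" "p ^ i dvd y" by (auto simp: D_def)
    then obtain u v where "x = p ^ i * u" "y = p ^ i * v" unfolding dvd_def by blast
    with xy p1 have uv: "(p ^ i * u, p ^ i * v) \<in> A" "\<not> p dvd u \<or> \<not> p dvd v"
      by (auto simp: mult.commute[of p])
    show ?thesis
    proof (cases "\<exists>u v. (p ^ i * u, p ^ i * v) \<in> A \<and> \<not> p dvd v")
      case True
      then obtain u v where uv: "(p ^ i * u, p ^ i * v) \<in> A" "\<not> p dvd v" by blast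
      obtain j t where "i + j \<le> a" "t \<in> {0..<p ^ j}" "A = line_lattice p i j t"
        using eq_line_lattice[OF p A _ uv] i(1) by (auto simp: D_def)
      thus ?thesis
        by (intro image_eqI[of _ _ "(i, j, False, t)"])
           (auto simp: point_lattice_def plane_types_def proj_points_def)
    next
      case False
      have "\<exists>j t. i + j \<le> a \<and> t \<in> {0..<p ^ j} \<and> prod.swap ` A = line_lattice p i j t"
        using i(1) uv False
        by (intro eq_line_lattice[OF p swap_in_lattices[OF A], where u = v and v = u]) (auto simp: D_def)
      then obtain j t where jt: "i + j \<le> a" "t \<in> {0..<p ^ j}" "prod.swap ` A = line_lattice p i j t"
        by blast
      have A_eq: "A = prod.swap ` line_lattice p i j t"
        unfolding jt(3)[symmetric] by (simp add: image_image)
      have mem: "(y, x) \<in> A" if "(x, y) \<in> line_lattice p i j t" for x y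
        unfolding A_eq using that by force
      have "(p ^ i * 1, p ^ i * t) \<in> A" by (rule mem) (auto simp: line_lattice_def)
      with False have "p dvd t" by blast
      have "(p ^ i * 0, p ^ i * p ^ j) \<in> A" by (rule mem) (auto simp: line_lattice_def power_add)
      with False have "p dvd p ^ j" by blast
      hence "j \<noteq> 0" using p1 by (intro notI) auto
      with jt A_eq \<open>p dvd t\<close> show ?thesis
        by (intro image_eqI[of _ _ "(i, j, True, t)"])
           (auto simp: point_lattice_def plane_types_def proj_points_def)
    qed
  qed
  ultimately show ?thesis unfolding bij_betw_def by blast
qed

section \<open>The number of subgroups for prime powers\<close>

lemma card_torsion_residues:
  fixes p :: int
  assumes "p > 1"
  shows "card {r\<in>{0..<p ^ m}. p ^ m dvd p ^ e * r} = nat p ^ min e m"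
proof (cases "m \<le> e")
  case True
  hence "{r\<in>{0..<p ^ m}. p ^ m dvd p ^ e * r} = {0..<p ^ m}"
    by (auto intro!: dvd_mult2 le_imp_power_dvd)
  thus ?thesis using True assms by (simp add: min_def nat_power_eq)
next
  case False
  hence m: "p ^ m = p ^ (m - e) * p ^ e" by (simp flip: power_add)
  have "p ^ m dvd p ^ e * r \<longleftrightarrow> p ^ (m - e) dvd r" for r
    unfolding m using assms by (simp add: mult.commute[of "p ^ e"])
  hence "{r\<in>{0..<p ^ m}. p ^ m dvd p ^ e * r} = {r\<in>{0..<p ^ (m - e) * p ^ e}. p ^ (m - e) dvd r}"
    by (simp add: m)
  also have "card \<dots> = nat (p ^ e)"
    using assms by (intro card_multiples_below) auto
  finally show ?thesis using False assms by (simp add: nat_power_eq min_def)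
qed

text \<open>
  The map sending \<open>(x, y)\<close> to \<open>x - t * y\<close> modulo \<open>p^(i+j)\<close> and \<open>y\<close> modulo \<open>p^i\<close> identifies the quotient with
  a product of two cyclic groups, in each of which the elements killed by \<open>p^e\<close> are easily counted.
\<close>

lemma card_cosets_line_lattice:
  fixes p :: int
  assumes "p > 1"
  shows "card (Z2.cosets (line_lattice p i j t) (p ^ e)) = nat p ^ (min e (i + j) + min e i)"
proof -
  define A where "A = line_lattice p i j t"
  define \<phi> where "\<phi> = (\<lambda>(x, y). ((x - t * y) mod p ^ (i + j), y mod p ^ i))"
  define R where "R m = {r\<in>{0..<p ^ m}. p ^ m dvd p ^ e * r}" for m
  have coset: "{w. w - v \<in> A} = {w. \<phi> w = \<phi> v}" for v
  proof -
    have "w - v \<in> A \<longleftrightarrow> \<phi> w = \<phi> v" for w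
    proof (cases w, cases v)
      fix x y x' y' assume [simp]: "w = (x, y)" "v = (x', y')"
      have eq: "x - x' - t * (y - y') = (x - t * y) - (x' - t * y')" by (simp only: right_diff_distrib)
      show ?thesis
        unfolding A_def line_lattice_def \<phi>_def by (simp add: mod_eq_dvd_iff conj_commute eq)
    qed
    thus ?thesis by blast
  qed
  have tors: "{v. scale2 (p ^ e) v \<in> A} = {(x, y). p ^ i dvd p ^ e * y \<and> p ^ (i + j) dvd p ^ e * (x - t * y)}"
    by (auto simp: A_def line_lattice_def scale2_def algebra_simps)
  have dvd_mod: "d dvd c * (r mod d) \<longleftrightarrow> d dvd c * r" for d c r :: int
    by (simp add: dvd_eq_mod_eq_0 mod_mult_right_eq)
  have image: "\<phi> ` {v. scale2 (p ^ e) v \<in> A} = R (i + j) \<times> R i"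
  proof (intro equalityI subsetI)
    fix z assume "z \<in> \<phi> ` {v. scale2 (p ^ e) v \<in> A}"
    thus "z \<in> R (i + j) \<times> R i"
      using assms by (auto simp: tors \<phi>_def R_def dvd_mod)
  next
    fix z assume "z \<in> R (i + j) \<times> R i"
    then obtain r s where z: "z = (r, s)" "r \<in> R (i + j)" "s \<in> R i" by auto
    have "\<phi> (r + t * s, s) = z" "(r + t * s, s) \<in> {v. scale2 (p ^ e) v \<in> A}"
      using z unfolding tors by (auto simp: \<phi>_def R_def)
    thus "z \<in> \<phi> ` {v. scale2 (p ^ e) v \<in> A}" by blast
  qed
  have "Z2.cosets A (p ^ e) = (\<lambda>z. {w. \<phi> w = z}) ` \<phi> ` {v. scale2 (p ^ e) v \<in> A}"
    by (simp add: Z2.cosets_def coset image_image)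
  moreover have "inj_on (\<lambda>z. {w. \<phi> w = z}) (range \<phi>)"
    by (rule inj_onI) blast
  hence "inj_on (\<lambda>z. {w. \<phi> w = z}) (\<phi> ` {v. scale2 (p ^ e) v \<in> A})"
    by (rule inj_on_subset) blast
  ultimately have "card (Z2.cosets A (p ^ e)) = card (\<phi> ` {v. scale2 (p ^ e) v \<in> A})"
    by (simp only: card_image)
  also have "\<dots> = nat p ^ min e (i + j) * nat p ^ min e i"
    unfolding image card_cartesian_product R_def card_torsion_residues[OF assms] ..
  finally show ?thesis by (simp add: A_def power_add)
qed

lemma card_cosets_swap: "card (Z2.cosets (prod.swap ` A) k) = card (Z2.cosets A k)"
proof -
  have mem: "u \<in> prod.swap ` A \<longleftrightarrow> prod.swap u \<in> A" for u :: "int \<times> int"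
    by (metis imageE imageI swap_swap)
  have eq: "{w. w - prod.swap v \<in> prod.swap ` A} = prod.swap ` {w. w - v \<in> A}" for v
  proof -
    have "w - prod.swap v \<in> prod.swap ` A \<longleftrightarrow> prod.swap w - v \<in> A" for w
      unfolding mem by (simp add: prod_eq_iff minus_prod_def)
    thus ?thesis by (auto intro!: image_eqI[of _ prod.swap "prod.swap _"])
  qed
  have "{v. scale2 k v \<in> prod.swap ` A} = prod.swap ` {v. scale2 k v \<in> A}"
    unfolding mem by (auto simp: scale2_def intro!: image_eqI[of _ prod.swap "prod.swap _"])
  hence "Z2.cosets (prod.swap ` A) k = (`) prod.swap ` Z2.cosets A k"
    by (simp add: Z2.cosets_def image_image eq)
  moreover have "inj_on ((`) prod.swap) (Z2.cosets A k)"
    by (auto simp: inj_on_def inj_image_eq_iff)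
  ultimately show ?thesis by (simp add: card_image)
qed

lemma card_cosets_point_lattice:
  fixes p :: int
  assumes "p > 1"
  shows "card (Z2.cosets (point_lattice p (i, j, s, t)) (p ^ e)) = nat p ^ (min e (i + j) + min e i)"
  using card_cosets_line_lattice[OF assms, of i j t e]
  by (simp add: point_lattice_def card_cosets_swap)

lemma subgroup_count_mult:
  assumes "coprime m n" "m > 0" "n > 0"
  shows "subgroup_count (m * n) = subgroup_count m * subgroup_count n"
  using assms Z3.card_lattices_mult[of "int m" "int n"] by (simp add: subgroup_count_eq_card_lattices)

text \<open>
  The sum runs over the plane lattices \<open>A\<close>, grouped by their type \<open>(i, j)\<close>. The factor in front counts the
  points of the projective line over \<open>\<int>/p^j\<close>, and the inner sum counts the cosets of \<open>A\<close> killed by \<open>p^e\<close>,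
  where \<open>p^e\<close> is the cofactor of the generator of the first coordinates.
\<close>

lemma subgroup_count_prime_power:
  fixes p :: nat
  assumes p: "prime p"
  shows "subgroup_count (p ^ a) = (\<Sum>(i, j)\<in>plane_types a. (if j = 0 then 1 else p ^ j + p ^ (j - 1)) *
           (\<Sum>e\<le>a. p ^ (min e (i + j) + min e i)))"
proof -
  define q where "q = int p"
  have q: "prime q" "q > 1" "nat q = p" using p prime_gt_1_nat[OF p] by (simp_all add: q_def)
  define X where "X = {(i, j, z). (i, j) \<in> plane_types a \<and> z \<in> proj_points q j}"
  define B where "B = {b. 0 < b \<and> b dvd q ^ a}"
  have bij: "bij_betw (point_lattice q) X (Z2.lattices (q ^ a))"
    unfolding X_def by (rule bij_betw_point_lattice[OF q(1)])
  have X_Sigma: "X = (\<lambda>((i, j), z). (i, j, z)) ` (SIGMA (i, j):plane_types a. proj_points q j)"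
    by (auto simp: X_def intro!: image_eqI[of _ _ "((_, _), _)"])
  have finX: "finite X"
    unfolding X_Sigma using finite_plane_types finite_proj_points by (intro finite_imageI finite_SigmaI) auto
  have finL: "finite (Z2.lattices (q ^ a))"
    using bij_betw_finite[OF bij] finX by simp
  have bijB: "bij_betw (\<lambda>e. q ^ (a - e)) {..a} B"
  proof (rule bij_betw_imageI)
    show "inj_on (\<lambda>e. q ^ (a - e)) {..a}"
      using q(2) by (auto simp: inj_on_def)
    have "b \<in> (\<lambda>e. q ^ (a - e)) ` {..a}" if "b \<in> B" for b
    proof -
      from that obtain m where "m \<le> a" "b = q ^ m"
        using divides_primepow[OF q(1), of b a] by (auto simp: B_def)
      thus ?thesis by (intro image_eqI[of _ _ "a - m"]) auto
    qed
    thus "(\<lambda>e. q ^ (a - e)) ` {..a} = B"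
      using q(2) by (auto simp: B_def intro!: le_imp_power_dvd)
  qed
  have finB: "finite B" using bij_betw_finite[OF bijB] by simp
  have cos: "card (Z2.cosets A (q ^ e)) > 0" if "A \<in> Z2.lattices (q ^ a)" for A e
  proof -
    from that obtain z where z: "A = point_lattice q z"
      using bij_betw_imp_surj_on[OF bij] by blast
    obtain i j s t where "z = (i, j, s, t)" by (metis prod_cases4)
    thus ?thesis using q(2) by (simp add: z card_cosets_point_lattice)
  qed
  have fin_cos: "finite (Z2.cosets A (q ^ a div b))" if "A \<in> Z2.lattices (q ^ a)" "b \<in> B" for A b
  proof -
    from that(2) obtain e where "e \<le> a" "b = q ^ (a - e)"
      using bij_betw_imp_surj_on[OF bijB] by blast
    hence "q ^ a div b = q ^ e" using q(2) by (simp flip: power_diff)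
    thus ?thesis using cos[OF that(1), of e] by (metis card_gt_0_iff)
  qed
  have "subgroup_count (p ^ a) = card (Z3.lattices (q ^ a))"
    using prime_gt_0_nat[OF p] by (simp add: subgroup_count_eq_card_lattices q_def)
  also have "\<dots> = card (SIGMA A:Z2.lattices (q ^ a). SIGMA b:B. Z2.cosets A (q ^ a div b))"
    using bij_betw_same_card[OF Z2.bij_betw_lattices_prod[of "q ^ a"]] q(2)
    by (simp add: scale3_def B_def)
  also have "\<dots> = (\<Sum>A\<in>Z2.lattices (q ^ a). \<Sum>b\<in>B. card (Z2.cosets A (q ^ a div b)))"
    using finL finB fin_cos by (simp add: card_SigmaI finite_SigmaI)
  also have "\<dots> = (\<Sum>A\<in>Z2.lattices (q ^ a). \<Sum>e\<le>a. card (Z2.cosets A (q ^ e)))"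
  proof (rule sum.cong[OF refl])
    fix A
    have "(\<Sum>b\<in>B. card (Z2.cosets A (q ^ a div b))) = (\<Sum>e\<le>a. card (Z2.cosets A (q ^ a div q ^ (a - e))))"
      by (rule sum.reindex_bij_betw[OF bijB, symmetric])
    also have "\<dots> = (\<Sum>e\<le>a. card (Z2.cosets A (q ^ e)))"
      by (intro sum.cong refl) (use q(2) in \<open>simp flip: power_diff\<close>)
    finally show "(\<Sum>b\<in>B. card (Z2.cosets A (q ^ a div b))) = (\<Sum>e\<le>a. card (Z2.cosets A (q ^ e)))" .
  qed
  also have "\<dots> = (\<Sum>z\<in>X. \<Sum>e\<le>a. card (Z2.cosets (point_lattice q z) (q ^ e)))"
    by (rule sum.reindex_bij_betw[OF bij, symmetric])
  also have "\<dots> = (\<Sum>((i, j), z)\<in>(SIGMA (i, j):plane_types a. proj_points q j).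
                    \<Sum>e\<le>a. card (Z2.cosets (point_lattice q (i, j, z)) (q ^ e)))"
    unfolding X_Sigma by (subst sum.reindex) (auto simp: inj_on_def case_prod_unfold)
  also have "\<dots> = (\<Sum>((i, j), z)\<in>(SIGMA (i, j):plane_types a. proj_points q j).
                    \<Sum>e\<le>a. p ^ (min e (i + j) + min e i))"
    by (intro sum.cong refl) (use q in \<open>auto simp: card_cosets_point_lattice\<close>)
  also have "\<dots> = (\<Sum>(i, j)\<in>plane_types a. \<Sum>z\<in>proj_points q j. \<Sum>e\<le>a. p ^ (min e (i + j) + min e i))"
    using finite_plane_types finite_proj_points
    by (subst sum.Sigma[symmetric]) (auto simp: case_prod_unfold)
  also have "\<dots> = (\<Sum>(i, j)\<in>plane_types a. (if j = 0 then 1 else p ^ j + p ^ (j - 1)) *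
           (\<Sum>e\<le>a. p ^ (min e (i + j) + min e i)))"
    using card_proj_points[of q] q by (intro sum.cong refl) auto
  finally show ?thesis .
qed

section \<open>The generating function for prime powers\<close>

text \<open>
  The value of the subgroup count at \<open>q^a\<close> as a polynomial expression, over the integers so that differences
  can be formed.
\<close>

definition prime_power_type_sum :: "int \<Rightarrow> nat \<Rightarrow> int" where
  "prime_power_type_sum q a = (\<Sum>(i, j)\<in>plane_types a. (if j = 0 then 1 else q ^ j + q ^ (j - 1)) *
     (\<Sum>e\<le>a. q ^ (min e (i + j) + min e i)))"

text \<open>
  These are the coefficients of \<open>(1 + 2(q + 1)X + qX\<^sup>2) / (1 - X)\<^sup>2\<close>. They are linear in \<open>k\<close> from \<open>k = 1\<close> on; at
  \<open>k = 0\<close> the linear formula would give the wrong value \<open>1 - q\<close>.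
\<close>

definition cofactor_prime_power :: "int \<Rightarrow> nat \<Rightarrow> int" where
  "cofactor_prime_power q k = (if k = 0 then 1 else 3 * int k * (q + 1) + 1 - q)"

lemma sum_plane_types_Suc:
  fixes f :: "nat \<Rightarrow> nat \<Rightarrow> int"
  shows "(\<Sum>(i, j)\<in>plane_types (Suc a). f i j) =
     (\<Sum>(i, j)\<in>plane_types a. f i j) + (\<Sum>i\<le>Suc a. f i (Suc a - i))"
proof -
  have "plane_types (Suc a) = plane_types a \<union> (\<lambda>i. (i, Suc a - i)) ` {..Suc a}"
    by (auto simp: plane_types_def image_iff)
  moreover have "plane_types a \<inter> (\<lambda>i. (i, Suc a - i)) ` {..Suc a} = {}"
    by (auto simp: plane_types_def)
  moreover have "(\<Sum>(i, j)\<in>(\<lambda>i. (i, Suc a - i)) ` {..Suc a}. f i j) = (\<Sum>i\<le>Suc a. f i (Suc a - i))"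
    by (subst sum.reindex) (auto simp: inj_on_def)
  ultimately show ?thesis
    by (simp add: sum.union_disjoint finite_plane_types del: sum.atMost_Suc)
qed

text \<open>
  A geometric sum whose ratio changes from \<open>q\<^sup>2\<close> to \<open>q\<close> at \<open>e = i\<close>. It is stated with the factor \<open>q\<^sup>2 - 1\<close> since
  this is how it enters the difference of the sums for \<open>(i + 1, a + 1)\<close> and \<open>(i, a)\<close>.
\<close>

lemma truncated_power_sum:
  fixes q :: int
  assumes "i \<le> a"
  shows "(q ^ 2 - 1) * (\<Sum>e\<le>a. q ^ (e + min e i)) =
           q ^ (2 * i) * (q ^ (a - i + 2) + q ^ (a - i + 1) - q) - 1"
  using assms
proof (induction i arbitrary: a)
  case 0
  have "(q - 1) * (\<Sum>e\<le>a. q ^ e) = q ^ Suc a - 1"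
    by (induction a) (simp_all add: algebra_simps)
  hence "(q + 1) * ((q - 1) * (\<Sum>e\<le>a. q ^ e)) = (q + 1) * (q ^ Suc a - 1)" by simp
  moreover have "(q + 1) * ((q - 1) * (\<Sum>e\<le>a. q ^ e)) = (q ^ 2 - 1) * (\<Sum>e\<le>a. q ^ e)"
    by (simp add: power2_eq_square algebra_simps)
  ultimately show ?case by (simp add: algebra_simps power2_eq_square)
next
  case (Suc i)
  then obtain b where b: "a = Suc b" "i \<le> b" by (cases a) auto
  have "(\<Sum>e\<le>a. q ^ (e + min e (Suc i))) = 1 + (\<Sum>e\<le>b. q ^ (Suc e + min (Suc e) (Suc i)))"
    unfolding b by (subst sum.atMost_Suc_shift) simp
  also have "(\<Sum>e\<le>b. q ^ (Suc e + min (Suc e) (Suc i))) = q ^ 2 * (\<Sum>e\<le>b. q ^ (e + min e i))"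
    by (simp add: sum_distrib_left power2_eq_square mult_ac)
  finally have "(q ^ 2 - 1) * (\<Sum>e\<le>a. q ^ (e + min e (Suc i))) =
      q ^ 2 - 1 + q ^ 2 * ((q ^ 2 - 1) * (\<Sum>e\<le>b. q ^ (e + min e i)))"
    by (simp add: algebra_simps)
  also have "\<dots> = q ^ 2 - 1 + q ^ 2 * (q ^ (2 * i) * (q ^ (b - i + 2) + q ^ (b - i + 1) - q) - 1)"
    using Suc.IH[OF b(2)] by simp
  also have "\<dots> = q ^ (2 * Suc i) * (q ^ (a - Suc i + 2) + q ^ (a - Suc i + 1) - q) - 1"
    using b by (simp add: algebra_simps power2_eq_square)
  finally show ?case .
qed

text \<open>
  Second differences correspond to multiplication of the generating function by \<open>(1 - X)\<^sup>2\<close>. They count the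
  lattices that are primitive and of exact level \<open>q^(a+2)\<close>, which is why they have a simple closed form.
  The first difference has two parts: \<open>P\<close> comes from the new summand \<open>e = a + 1\<close> in the inner sums, and \<open>U\<close>
  from the new types with \<open>i + j = a + 1\<close>.
\<close>

lemma second_difference_type_sum:
  fixes q :: int
  shows "prime_power_type_sum q (a + 2) - 2 * prime_power_type_sum q (a + 1) + prime_power_type_sum q a =
    q ^ (2 * a + 1) * (q ^ 2 + q + 1) * ((int a + 3) * q + (int a + 1))"
proof -
  define \<psi> where "\<psi> j = (if j = 0 then 1 else q ^ j + q ^ (j - 1))" for j :: nat
  define T where "T = prime_power_type_sum q"
  define P where "P a = (\<Sum>(i, j)\<in>plane_types a. \<psi> j * q ^ (2 * i + j))" for a
  define V where "V i a = (\<Sum>e\<le>a. q ^ (e + min e i))" for i a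
  define U where "U a = (\<Sum>i\<le>a. \<psi> (a - i) * V i a)" for a
  have T: "T (Suc a) - T a = P a + U (Suc a)" for a
  proof -
    have "T (Suc a) = (\<Sum>(i, j)\<in>plane_types a. \<psi> j * (\<Sum>e\<le>Suc a. q ^ (min e (i + j) + min e i))) +
        (\<Sum>i\<le>Suc a. \<psi> (Suc a - i) * (\<Sum>e\<le>Suc a. q ^ (min e (i + (Suc a - i)) + min e i)))"
      unfolding T_def prime_power_type_sum_def \<psi>_def[symmetric] by (rule sum_plane_types_Suc)
    also have "(\<Sum>i\<le>Suc a. \<psi> (Suc a - i) * (\<Sum>e\<le>Suc a. q ^ (min e (i + (Suc a - i)) + min e i))) = U (Suc a)"
      unfolding U_def V_def by (intro sum.cong refl arg_cong2[of _ _ _ _ "(*)"]) auto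
    also have "(\<Sum>(i, j)\<in>plane_types a. \<psi> j * (\<Sum>e\<le>Suc a. q ^ (min e (i + j) + min e i))) =
        (\<Sum>(i, j)\<in>plane_types a. \<psi> j * (\<Sum>e\<le>a. q ^ (min e (i + j) + min e i)) + \<psi> j * q ^ (2 * i + j))"
      by (intro sum.cong refl)
         (auto simp: plane_types_def min_def distrib_left mult_2 add_ac)
    also have "\<dots> = T a + P a"
      by (simp add: T_def prime_power_type_sum_def P_def \<psi>_def case_prod_unfold sum.distrib)
    finally show ?thesis by simp
  qed
  have P: "P (Suc a) - P a = (\<Sum>i\<le>Suc a. \<psi> (Suc a - i) * q ^ (Suc a + i))" for a
    unfolding P_def by (subst sum_plane_types_Suc) (auto intro!: sum.cong simp: mult_2 add.commute simp del: sum.atMost_Suc)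
  have U: "U (Suc n) - U n = \<psi> (Suc n) * V 0 (Suc n) +
      (\<Sum>i\<le>n. \<psi> (n - i) * (q ^ (2 * i) * (q ^ (n - i + 2) + q ^ (n - i + 1) - q)))" for n
  proof -
    have V: "V (Suc i) (Suc n) = 1 + q ^ 2 * V i n" for i
    proof -
      have "V (Suc i) (Suc n) = 1 + (\<Sum>e\<le>n. q ^ (Suc e + min (Suc e) (Suc i)))"
        unfolding V_def by (subst sum.atMost_Suc_shift) simp
      also have "(\<Sum>e\<le>n. q ^ (Suc e + min (Suc e) (Suc i))) = q ^ 2 * V i n"
        by (simp add: V_def sum_distrib_left power2_eq_square mult_ac)
      finally show ?thesis .
    qed
    have V': "V (Suc i) (Suc n) = V i n + q ^ (2 * i) * (q ^ (n - i + 2) + q ^ (n - i + 1) - q)"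
      if "i \<le> n" for i
      using truncated_power_sum[OF that, of q] V[of i] by (simp add: V_def[symmetric] left_diff_distrib)
    have "U (Suc n) = \<psi> (Suc n) * V 0 (Suc n) + (\<Sum>i\<le>n. \<psi> (n - i) * V (Suc i) (Suc n))"
      unfolding U_def by (subst sum.atMost_Suc_shift) simp
    also have "(\<Sum>i\<le>n. \<psi> (n - i) * V (Suc i) (Suc n)) = U n +
        (\<Sum>i\<le>n. \<psi> (n - i) * (q ^ (2 * i) * (q ^ (n - i + 2) + q ^ (n - i + 1) - q)))"
      unfolding U_def by (subst sum.distrib[symmetric]) (intro sum.cong refl, simp add: V' distrib_left)
    finally show ?thesis by simp
  qed
  define n where "n = Suc a"
  have V0: "V 0 (Suc n) = (\<Sum>e<n. q ^ e) + q ^ n + q ^ Suc n"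
    by (simp add: V_def lessThan_Suc_atMost[symmetric])
  have "T (a + 2) - 2 * T (a + 1) + T a = P (Suc a) - P a + (U (Suc n) - U n)"
    using T[of "Suc a"] T[of a] by (simp add: n_def)
  also have "\<dots> = \<psi> (Suc n) * V 0 (Suc n) +
      (\<Sum>i\<le>n. \<psi> (n - i) * (q ^ (n + i) + q ^ (2 * i) * (q ^ (n - i + 2) + q ^ (n - i + 1) - q)))"
    unfolding U P[of a, folded n_def] n_def[symmetric] by (simp add: distrib_left sum.distrib)
  also have "(\<Sum>i\<le>n. \<psi> (n - i) * (q ^ (n + i) + q ^ (2 * i) * (q ^ (n - i + 2) + q ^ (n - i + 1) - q))) =
      (\<Sum>i<n. (q + 1) * (q ^ (2 * n - 1) * (1 + q + q ^ 2)) - (q + 1) * (q ^ n * q ^ i)) + q ^ (2 * n) * (1 + q ^ 2)"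
    unfolding lessThan_Suc_atMost[symmetric] sum.lessThan_Suc
  proof (intro arg_cong2[of _ _ _ _ "(+)"] sum.cong refl)
    fix i assume "i \<in> {..<n}"
    then obtain j where j: "n = i + Suc j" by (metis lessThan_iff less_iff_Suc_add add_Suc_right)
    show "\<psi> (n - i) * (q ^ (n + i) + q ^ (2 * i) * (q ^ (n - i + 2) + q ^ (n - i + 1) - q)) =
        (q + 1) * (q ^ (2 * n - 1) * (1 + q + q ^ 2)) - (q + 1) * (q ^ n * q ^ i)"
      by (simp add: j \<psi>_def algebra_simps power_add power_mult power2_eq_square)
  next
    show "\<psi> (n - n) * (q ^ (n + n) + q ^ (2 * n) * (q ^ (n - n + 2) + q ^ (n - n + 1) - q)) =
            q ^ (2 * n) * (1 + q ^ 2)"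
      by (simp add: \<psi>_def distrib_left power2_eq_square flip: mult_2)
  qed
  also have "(\<Sum>i<n. (q + 1) * (q ^ (2 * n - 1) * (1 + q + q ^ 2)) - (q + 1) * (q ^ n * q ^ i)) =
      int n * ((q + 1) * (q ^ (2 * n - 1) * (1 + q + q ^ 2))) - (q + 1) * (q ^ n * (\<Sum>i<n. q ^ i))"
    by (simp add: sum_subtractf sum_distrib_left)
  also have "\<psi> (Suc n) * V 0 (Suc n) + (int n * ((q + 1) * (q ^ (2 * n - 1) * (1 + q + q ^ 2))) -
      (q + 1) * (q ^ n * (\<Sum>i<n. q ^ i)) + q ^ (2 * n) * (1 + q ^ 2)) =
      q ^ (2 * a + 1) * (q ^ 2 + q + 1) * ((int a + 3) * q + (int a + 1))"
    unfolding V0 by (simp add: \<psi>_def n_def algebra_simps power_mult power2_eq_square)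
  finally show ?thesis by (simp add: T_def)
qed

text \<open>
  The second differences of \<^const>\<open>cofactor_prime_power\<close> vanish from the index \<open>3\<close> on, so only the last three
  terms of the convolution contribute.
\<close>

lemma second_difference_convolution:
  fixes q :: int
  defines "C \<equiv> (\<lambda>a. \<Sum>e\<le>a. (int e + 1) * q ^ (2 * e) * cofactor_prime_power q (a - e))"
  shows "C (a + 2) - 2 * C (a + 1) + C a =
    q ^ (2 * a + 1) * (q ^ 2 + q + 1) * ((int a + 3) * q + (int a + 1))"
proof -
  define h where "h = cofactor_prime_power q"
  define c where "c e = (int e + 1) * q ^ (2 * e)" for e
  have h: "h 0 = 1" "h (Suc 0) = 2 * q + 4" "\<And>k. h (k + 2) - 2 * h (k + 1) + h k = (if k = 0 then q else 0)"
    by (auto simp: h_def cofactor_prime_power_def algebra_simps)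
  have C: "C a = (\<Sum>e\<le>a. c e * h (a - e))" for a
    by (simp add: C_def c_def h_def)
  have C2: "C (a + 2) = (\<Sum>e\<le>a. c e * h ((a - e) + 2)) + c (a + 1) * h (Suc 0) + c (a + 2) * h 0"
    unfolding C by (simp add: Suc_diff_le)
  have C1: "C (a + 1) = (\<Sum>e\<le>a. c e * h ((a - e) + 1)) + c (a + 1) * h 0"
    unfolding C by (simp add: Suc_diff_le)
  have "(\<Sum>e\<le>a. c e * (h ((a - e) + 2) - 2 * h ((a - e) + 1) + h (a - e))) =
      (\<Sum>e\<le>a. c e * h ((a - e) + 2)) - 2 * (\<Sum>e\<le>a. c e * h ((a - e) + 1)) + (\<Sum>e\<le>a. c e * h (a - e))"
    by (simp add: distrib_left right_diff_distrib sum.distrib sum_subtractf sum_distrib_left mult.left_commute)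
  hence "C (a + 2) - 2 * C (a + 1) + C a =
      (\<Sum>e\<le>a. c e * (h ((a - e) + 2) - 2 * h ((a - e) + 1) + h (a - e))) +
      c (a + 1) * (h (Suc 0) - 2 * h 0) + c (a + 2) * h 0"
    unfolding C2 C1 C[of a] by (simp add: right_diff_distrib)
  also have "(\<Sum>e\<le>a. c e * (h ((a - e) + 2) - 2 * h ((a - e) + 1) + h (a - e))) = (\<Sum>e\<le>a. if e = a then c a * q else 0)"
    unfolding h(3) by (intro sum.cong refl) auto
  also have "\<dots> = c a * q" by simp
  finally show ?thesis
    by (simp add: h c_def algebra_simps power2_eq_square)
qed

text \<open>
  Both sides have the same second differences, and they agree for \<open>a = 0\<close> and \<open>a = 1\<close>.
\<close>

lemma prime_power_type_sum_eq_convolution: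
  "prime_power_type_sum q a =
     (\<Sum>e\<le>a. (int e + 1) * q ^ (2 * e) * cofactor_prime_power q (a - e))"
proof (induction a rule: less_induct)
  case (less a)
  have "plane_types 0 = {(0, 0)}" "plane_types 1 = {(0, 0), (0, 1), (1, 0)}"
    by (auto simp: plane_types_def)
  hence base: "prime_power_type_sum q 0 = 1" "prime_power_type_sum q 1 = 2 * q ^ 2 + 2 * q + 4"
    by (simp_all add: prime_power_type_sum_def algebra_simps power2_eq_square)
  consider "a = 0" | "a = 1" | b where "a = b + 2"
    by (metis One_nat_def add_2_eq_Suc' not0_implies_Suc)
  thus ?case
  proof cases
    case (3 b)
    show ?thesis
      using second_difference_type_sum[of q b] second_difference_convolution[of q b]
        less.IH[of b] less.IH[of "b + 1"] unfolding 3 by simp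
  qed (use base in \<open>simp_all add: cofactor_prime_power_def algebra_simps power2_eq_square\<close>)
qed

section \<open>The function \<open>h\<close>: multiplicativity and size\<close>

definition multiplicative :: "(nat \<Rightarrow> 'a :: comm_semiring_1) \<Rightarrow> bool" where
  "multiplicative f \<longleftrightarrow> f 1 = 1 \<and> (\<forall>m>0. \<forall>n>0. coprime m n \<longrightarrow> f (m * n) = f m * f n)"

lemma multiplicativeD:
  assumes "multiplicative f"
  shows "f (Suc 0) = 1" "coprime m n \<Longrightarrow> m > 0 \<Longrightarrow> n > 0 \<Longrightarrow> f (m * n) = f m * f n"
  using assms by (auto simp: multiplicative_def)

lemma coprime_prime_power_induct [consumes 1, case_names one prime_power mult]:
  assumes "n > 0" and one: "P 1"
    and prime_power: "\<And>p k. prime p \<Longrightarrow> k > 0 \<Longrightarrow> P (p ^ k)"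
    and mult: "\<And>m n. coprime m n \<Longrightarrow> m > 0 \<Longrightarrow> n > 0 \<Longrightarrow> P m \<Longrightarrow> P n \<Longrightarrow> P (m * n)"
  shows "P (n :: nat)"
  using assms(1)
proof (induction n rule: less_induct)
  case (less n)
  show ?case
  proof (cases "n = 1")
    case False
    then obtain p where p: "prime p" "p dvd n" using prime_factor_nat by blast
    define k where "k = multiplicity p n"
    have k: "k > 0" using p less.prems by (simp add: k_def prime_multiplicity_gt_zero_iff)
    obtain m where m: "n = p ^ k * m" "\<not> p dvd m"
      using multiplicity_decompose'[of n p] p less.prems prime_gt_1_nat[OF p(1)] unfolding k_def
      by auto
    have "m > 0" using m less.prems by (cases m) auto
    have "p ^ k > 1" using one_less_power[OF prime_gt_1_nat[OF p(1)] k] .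
    hence "m < n" using m \<open>m > 0\<close> by simp
    have "coprime (p ^ k) m" using m(2) p(1) by (simp add: prime_imp_coprime)
    moreover have "p ^ k > 0" using \<open>p ^ k > 1\<close> by linarith
    ultimately show ?thesis
      unfolding m(1) using less.IH[OF \<open>m < n\<close> \<open>m > 0\<close>] \<open>m > 0\<close> prime_power[OF p(1) k] by (intro mult)
  qed (use one in simp)
qed

text \<open>
  The inverse map sends a divisor \<open>d\<close> of \<open>m * n\<close> to the pair of \<open>gcd d m\<close> and \<open>gcd d n\<close>.
\<close>

lemma bij_betw_divisors_mult:
  fixes m n :: nat
  assumes mn: "coprime m n" "m > 0" "n > 0"
  shows "bij_betw (\<lambda>(a, b). a * b) ({a. a dvd m} \<times> {b. b dvd n}) {d. d dvd m * n}"
proof (rule bij_betw_imageI)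
  show "inj_on (\<lambda>(a, b). a * b) ({a. a dvd m} \<times> {b. b dvd n})"
  proof (rule inj_onI, clarify)
    fix a b a' b' assume *: "a dvd m" "b dvd n" "a' dvd m" "b' dvd n" "a * b = a' * b'"
    have "gcd (a * b) m = a" if "a dvd m" "b dvd n" for a b
    proof -
      have "coprime b m" using that mn by (meson coprime_commute coprime_divisors dvd_refl)
      hence "gcd (a * b) m = gcd a m" by (metis gcd_mult_left_right_cancel coprime_commute)
      thus ?thesis using that by (simp add: gcd_nat.absorb1)
    qed
    hence "a = a'" using * by metis
    moreover have "a > 0" using * mn by (auto intro: Nat.gr0I)
    ultimately show "a = a' \<and> b = b'" using * by simp
  qed
  show "(\<lambda>(a, b). a * b) ` ({a. a dvd m} \<times> {b. b dvd n}) = {d. d dvd m * n}"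
  proof (intro equalityI subsetI)
    fix d assume "d \<in> {d. d dvd m * n}"
    then obtain a b where "d = a * b" "a dvd m" "b dvd n" using division_decomp[of d m n] by blast
    thus "d \<in> (\<lambda>(a, b). a * b) ` ({a. a dvd m} \<times> {b. b dvd n})" by auto
  qed (auto intro: mult_dvd_mono)
qed

lemma multiplicative_convolution:
  fixes f g :: "nat \<Rightarrow> 'a :: comm_semiring_1"
  assumes f: "multiplicative f" and g: "multiplicative g"
  shows "multiplicative (\<lambda>n. \<Sum>d | d dvd n. f d * g (n div d))"
  unfolding multiplicative_def
proof (intro conjI allI impI)
  show "(\<Sum>d | d dvd 1. f d * g (1 div d)) = 1"
    using multiplicativeD(1)[OF f] multiplicativeD(1)[OF g] by simp
  fix m n :: nat assume mn: "m > 0" "n > 0" "coprime m n"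
  have "(\<Sum>d | d dvd m * n. f d * g (m * n div d)) =
      (\<Sum>(a, b)\<in>{a. a dvd m} \<times> {b. b dvd n}. f (a * b) * g (m * n div (a * b)))"
    using sum.reindex_bij_betw[OF bij_betw_divisors_mult[OF mn(3,1,2)], of "\<lambda>d. f d * g (m * n div d)"]
    by (simp add: case_prod_unfold)
  also have "\<dots> = (\<Sum>(a, b)\<in>{a. a dvd m} \<times> {b. b dvd n}. (f a * g (m div a)) * (f b * g (n div b)))"
  proof (intro sum.cong refl, clarify)
    fix a b assume ab: "a dvd m" "b dvd n"
    then obtain a' b' where ab': "m = a * a'" "n = b * b'" by (elim dvdE)
    have "a > 0" "b > 0" "a' > 0" "b' > 0" using ab' mn by auto
    moreover have "coprime a b" "coprime a' b'"
      using mn(3) unfolding ab' by auto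
    moreover have "m * n div (a * b) = a' * b'"
      using \<open>a > 0\<close> \<open>b > 0\<close> by (simp add: ab' mult_ac)
    ultimately show "f (a * b) * g (m * n div (a * b)) = (f a * g (m div a)) * (f b * g (n div b))"
      using multiplicativeD(2)[OF f] multiplicativeD(2)[OF g] by (simp add: ab' mult_ac)
  qed
  also have "\<dots> = (\<Sum>d | d dvd m. f d * g (m div d)) * (\<Sum>d | d dvd n. f d * g (n div d))"
    by (simp add: sum_product sum.cartesian_product)
  finally show "(\<Sum>d | d dvd m * n. f d * g (m * n div d)) =
    (\<Sum>d | d dvd m. f d * g (m div d)) * (\<Sum>d | d dvd n. f d * g (n div d))" .
qed

lemma sum_divisors_prime_power:
  fixes p :: nat
  assumes "prime p"
  shows "(\<Sum>d | d dvd p ^ a. f d) = (\<Sum>e\<le>a. f (p ^ e))"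
proof -
  have "{d. d dvd p ^ a} = (\<lambda>e. p ^ e) ` {..a}"
    using assms by (auto simp: divides_primepow_nat)
  moreover have "inj_on (\<lambda>e. p ^ e) {..a}"
    using prime_gt_1_nat[OF assms] by (auto simp: inj_on_def)
  ultimately show ?thesis by (simp add: sum.reindex)
qed

lemma divisor_count_eq_sum: "divisor_count n = (\<Sum>d | d dvd n. 1)"
  by (simp add: divisor_count_def)

lemma multiplicative_divisor_count: "multiplicative divisor_count"
  using multiplicative_convolution[of "\<lambda>_. 1 :: nat" "\<lambda>_. 1"]
  by (simp add: multiplicative_def divisor_count_eq_sum)

lemma divisor_count_prime_power: "prime p \<Longrightarrow> divisor_count (p ^ k) = k + 1"
  unfolding divisor_count_eq_sum by (subst sum_divisors_prime_power) simp_all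

lemma divisor_count_mult_le:
  assumes "a > 0" "b > 0"
  shows "divisor_count (a * b) \<le> divisor_count a * divisor_count b"
proof -
  have "{d. d dvd a * b} \<subseteq> (\<lambda>(x, y). x * y) ` ({x. x dvd a} \<times> {y. y dvd b})"
  proof
    fix d assume "d \<in> {d. d dvd a * b}"
    then obtain x y where "d = x * y" "x dvd a" "y dvd b" using division_decomp[of d a b] by blast
    thus "d \<in> (\<lambda>(x, y). x * y) ` ({x. x dvd a} \<times> {y. y dvd b})" by auto
  qed
  hence "card {d. d dvd a * b} \<le> card ({x. x dvd a} \<times> {y. y dvd b})"
    using assms by (intro surj_card_le) auto
  thus ?thesis by (simp add: divisor_count_def card_cartesian_product)
qed

text \<open>
  The explicit form of \<open>h\<close>; see \<open>h_coeff_eq_cofactor\<close>.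
\<close>

definition cofactor :: "nat \<Rightarrow> int" where
  "cofactor n = (\<Prod>p\<in>prime_factors n. cofactor_prime_power (int p) (multiplicity p n))"

lemma cofactor_prime_power:
  assumes "prime p"
  shows "cofactor (p ^ k) = cofactor_prime_power (int p) k"
  using assms by (cases "k = 0")
    (auto simp: cofactor_def prime_factorization_prime_power cofactor_prime_power_def)

lemma multiplicative_cofactor: "multiplicative cofactor"
  unfolding multiplicative_def
proof (intro conjI allI impI)
  show "cofactor 1 = 1" by (simp add: cofactor_def)
  fix m n :: nat assume mn: "m > 0" "n > 0" "coprime m n"
  have nd: "\<not> p dvd n" if "p \<in> prime_factors m" for p
    using that mn(3) by (metis coprime_common_divisor_nat in_prime_factors_iff not_prime_1)
  have nd': "\<not> p dvd m" if "p \<in> prime_factors n" for p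
    using that mn(3) by (metis coprime_common_divisor_nat in_prime_factors_iff not_prime_1)
  have "prime_factors (m * n) = prime_factors m \<union> prime_factors n"
    using mn by (simp add: prime_factorization_mult)
  moreover have "prime_factors m \<inter> prime_factors n = {}"
    using nd by (auto simp: in_prime_factors_iff)
  moreover have "multiplicity p (m * n) = multiplicity p m" if "p \<in> prime_factors m" for p
    using that mn nd[OF that]
    by (simp add: in_prime_factors_iff prime_elem_multiplicity_mult_distrib not_dvd_imp_multiplicity_0)
  moreover have "multiplicity p (m * n) = multiplicity p n" if "p \<in> prime_factors n" for p
    using that mn nd'[OF that]
    by (simp add: in_prime_factors_iff prime_elem_multiplicity_mult_distrib not_dvd_imp_multiplicity_0)
  ultimately show "cofactor (m * n) = cofactor m * cofactor n"
    by (simp add: cofactor_def prod.union_disjoint)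
qed

lemma multiplicative_eqI:
  assumes "multiplicative f" "multiplicative g"
    and "\<And>p k. prime p \<Longrightarrow> f (p ^ k) = g (p ^ k)" and "n > 0"
  shows "f n = g n"
  using \<open>n > 0\<close>
proof (induction n rule: coprime_prime_power_induct)
  case one
  thus ?case using assms(1,2)[THEN multiplicativeD(1)] by simp
next
  case (mult m n)
  thus ?case using assms(1,2)[THEN multiplicativeD(2)] by metis
qed (use assms(3) in auto)

lemma subgroup_count_eq_convolution_cofactor:
  assumes "n > 0"
  shows "int (subgroup_count n) = (\<Sum>d | d dvd n. int (d\<^sup>2 * divisor_count d) * cofactor (n div d))"
proof (rule multiplicative_eqI[OF _ _ _ assms])
  have "subgroup_count 1 = 1"
    using subgroup_count_prime_power[OF two_is_prime_nat, of 0] by (simp add: plane_types_def)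
  thus "multiplicative (\<lambda>n. int (subgroup_count n))"
    by (simp add: multiplicative_def subgroup_count_mult)
  have "multiplicative (\<lambda>d. int (d\<^sup>2 * divisor_count d))"
    using multiplicative_divisor_count by (simp add: multiplicative_def power_mult_distrib)
  thus "multiplicative (\<lambda>n. \<Sum>d | d dvd n. int (d\<^sup>2 * divisor_count d) * cofactor (n div d))"
    using multiplicative_cofactor by (rule multiplicative_convolution)
next
  fix p a :: nat assume p: "prime p"
  have "int (subgroup_count (p ^ a)) = prime_power_type_sum (int p) a"
    unfolding subgroup_count_prime_power[OF p] prime_power_type_sum_def of_nat_sum
    by (intro sum.cong refl) (auto intro!: arg_cong2[of _ _ _ _ "(*)"])
  also have "\<dots> = (\<Sum>e\<le>a. (int e + 1) * int p ^ (2 * e) * cofactor_prime_power (int p) (a - e))"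
    by (rule prime_power_type_sum_eq_convolution)
  also have "\<dots> = (\<Sum>e\<le>a. int ((p ^ e)\<^sup>2 * divisor_count (p ^ e)) * cofactor (p ^ a div p ^ e))"
  proof (intro sum.cong refl)
    fix e assume e: "e \<in> {..a}"
    hence "p ^ a div p ^ e = p ^ (a - e)"
      using prime_gt_0_nat[OF p] by (simp add: power_diff)
    thus "(int e + 1) * int p ^ (2 * e) * cofactor_prime_power (int p) (a - e) =
        int ((p ^ e)\<^sup>2 * divisor_count (p ^ e)) * cofactor (p ^ a div p ^ e)"
      using p by (simp add: cofactor_prime_power divisor_count_prime_power power_mult[symmetric] mult.commute distrib_right)
  qed
  also have "\<dots> = (\<Sum>d | d dvd p ^ a. int (d\<^sup>2 * divisor_count d) * cofactor (p ^ a div d))"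
    by (rule sum_divisors_prime_power[OF p, symmetric])
  finally show "int (subgroup_count (p ^ a)) = \<dots>" .
qed

lemma h_coeff_eq_cofactor: "n > 0 \<Longrightarrow> h_coeff n = cofactor n"
  using h_coeff_unique[of cofactor n] subgroup_count_eq_convolution_cofactor by simp

text \<open>
  Both bounds are multiplicative, so prime powers suffice. For the upper bound at a prime power,
  \<open>3k(p + 1) + 1 - p \<le> p (k + 1)\<^sup>2\<close> is equivalent to \<open>3k + 1 \<le> p (k\<^sup>2 - k + 2)\<close>, and since
  \<open>p \<ge> 2\<close> this follows from \<open>(2k - 3)(k - 1) \<ge> 0\<close>, which holds for every integer \<open>k\<close>.
\<close>

lemma cofactor_bounds:
  assumes "n > 0"
  shows "0 \<le> cofactor n \<and> cofactor n \<le> int (n * divisor_count n ^ 2)"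
  using assms
proof (induction n rule: coprime_prime_power_induct)
  case one
  thus ?case by (simp add: cofactor_def)
next
  case (prime_power p k)
  define q where "q = int p"
  define l where "l = int k"
  have q: "q \<ge> 2" using prime_ge_2_nat[OF prime_power(1)] by (simp add: q_def)
  have l: "l \<ge> 1" using prime_power(2) by (simp add: l_def)
  have c: "cofactor (p ^ k) = 3 * l * (q + 1) + 1 - q"
    using prime_power by (simp add: cofactor_prime_power cofactor_prime_power_def q_def l_def)
  have "1 * q \<le> l * q" using l q by (intro mult_right_mono) auto
  moreover have "0 \<le> l * q" using l q by simp
  ultimately have "0 \<le> cofactor (p ^ k)" using l unfolding c by (simp add: algebra_simps)
  moreover have "cofactor (p ^ k) \<le> q ^ k * (l + 1)\<^sup>2"
  proof -
    have "0 \<le> (2 * l - 3) * (l - 1)"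
      using l by (cases "l = 1") auto
    hence "3 * l + 1 \<le> 2 * (l * l - l + 2)" by (simp add: algebra_simps)
    also have "\<dots> \<le> q * (l * l - l + 2)"
    proof (rule mult_right_mono)
      have "1 * l \<le> l * l" using l by (intro mult_right_mono) auto
      thus "0 \<le> l * l - l + 2" by simp
    qed (use q in auto)
    finally have "cofactor (p ^ k) \<le> q * (l + 1)\<^sup>2"
      unfolding c by (simp add: algebra_simps power2_eq_square)
    also have "\<dots> \<le> q ^ k * (l + 1)\<^sup>2"
      using q prime_power(2) by (intro mult_right_mono self_le_power) auto
    finally show ?thesis .
  qed
  ultimately show ?case
    using prime_power(1) by (simp add: divisor_count_prime_power q_def l_def add.commute)
next
  case (mult m n)
  have "cofactor m * cofactor n \<le> int (m * divisor_count m ^ 2) * int (n * divisor_count n ^ 2)"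
    using mult by (intro mult_mono) auto
  thus ?case
    using mult multiplicativeD(2)[OF multiplicative_cofactor mult(1-3)]
      multiplicativeD(2)[OF multiplicative_divisor_count mult(1-3)]
    by (simp add: power_mult_distrib mult_ac)
qed

section \<open>Convergence of the Dirichlet series of \<open>h\<close>\<close>

text \<open>
  Both sides sum \<open>F d m\<close> over all pairs with \<open>d * m \<le> N\<close>.
\<close>

lemma sum_convolution:
  fixes F :: "nat \<Rightarrow> nat \<Rightarrow> 'a :: comm_monoid_add"
  shows "(\<Sum>n=1..N. \<Sum>d | d dvd n. F d (n div d)) = (\<Sum>d=1..N. \<Sum>m=1..N div d. F d m)"
proof -
  have "(\<Sum>n=1..N. \<Sum>d | d dvd n. F d (n div d)) =
      (\<Sum>(n, d)\<in>(SIGMA n:{1..N}. {d. d dvd n}). F d (n div d))"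
    by (rule sum.Sigma) auto
  also have "\<dots> = (\<Sum>(d, m)\<in>(SIGMA d:{1..N}. {1..N div d}). F d m)"
  proof (rule sum.reindex_bij_witness[where i = "\<lambda>(d, m). (d * m, d)" and j = "\<lambda>(n, d). (d, n div d)"])
    fix z assume "z \<in> (SIGMA n:{1..N}. {d. d dvd n})"
    then obtain d m where z: "z = (d * m, d)" "1 \<le> d * m" "d * m \<le> N" by (auto elim!: dvdE)
    hence "d > 0" "m > 0" by auto
    moreover from this have "d \<le> d * m" by simp
    with z have "d \<le> N" by linarith
    ultimately
    show "(case case z of (n, d) \<Rightarrow> (d, n div d) of (d, m) \<Rightarrow> (d * m, d)) = z"
      "(case z of (n, d) \<Rightarrow> (d, n div d)) \<in> (SIGMA d:{1..N}. {1..N div d})"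
      using z by (auto simp: less_eq_div_iff_mult_less_eq mult.commute)
  next
    fix z assume "z \<in> (SIGMA d:{1..N}. {1..N div d})"
    thus "(case case z of (d, m) \<Rightarrow> (d * m, d) of (n, d) \<Rightarrow> (d, n div d)) = z"
      "(case z of (d, m) \<Rightarrow> (d * m, d)) \<in> (SIGMA n:{1..N}. {d. d dvd n})"
      by (auto simp: less_eq_div_iff_mult_less_eq mult.commute)
  qed (auto simp: case_prod_unfold)
  also have "\<dots> = (\<Sum>d=1..N. \<Sum>m=1..N div d. F d m)"
    by (rule sum.Sigma[symmetric]) auto
  finally show ?thesis .
qed

lemma summable_convolution:
  fixes f g :: "nat \<Rightarrow> real"
  assumes nonneg: "\<And>n. f n \<ge> 0" "\<And>n. g n \<ge> 0"
    and f: "summable (\<lambda>n. f (Suc n))" and g: "summable (\<lambda>n. g (Suc n))"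
  shows "summable (\<lambda>n. \<Sum>d | d dvd Suc n. f d * g (Suc n div d))"
proof (rule summableI_nonneg_bounded)
  have shift: "(\<Sum>n=1..N. a n) = (\<Sum>n<N. a (Suc n))" for a :: "nat \<Rightarrow> real" and N
    by (rule sum.reindex_bij_witness[of _ Suc "\<lambda>n. n - 1"]) auto
  have le: "(\<Sum>n=1..N. a n) \<le> (\<Sum>n. a (Suc n))" if "\<And>n. a n \<ge> 0" "summable (\<lambda>n. a (Suc n))" for a :: "nat \<Rightarrow> real" and N
    unfolding shift using that by (intro sum_le_suminf) auto
  show "(\<Sum>n<N. \<Sum>d | d dvd Suc n. f d * g (Suc n div d)) \<le> (\<Sum>n. f (Suc n)) * (\<Sum>n. g (Suc n))" for N
  proof -
    have "(\<Sum>n<N. \<Sum>d | d dvd Suc n. f d * g (Suc n div d)) = (\<Sum>d=1..N. f d * (\<Sum>m=1..N div d. g m))"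
      unfolding shift[symmetric, of "\<lambda>n. \<Sum>d | d dvd n. f d * g (n div d)"]
      unfolding sum_convolution[where F = "\<lambda>d m. f d * g m"] sum_distrib_left ..
    also have "\<dots> \<le> (\<Sum>d=1..N. f d * (\<Sum>n. g (Suc n)))"
      by (intro sum_mono mult_left_mono le nonneg g)
    also have "\<dots> \<le> (\<Sum>n. f (Suc n)) * (\<Sum>n. g (Suc n))"
      unfolding sum_distrib_right[symmetric]
      by (intro mult_right_mono le nonneg f suminf_nonneg g)
    finally show ?thesis .
  qed
qed (auto intro!: sum_nonneg mult_nonneg_nonneg nonneg)

text \<open>
  As \<open>h(n) \<le> n \<tau>(n)\<^sup>2\<close>, it suffices to bound the series of \<open>\<tau>(n)\<^sup>2 n powr (1 - \<sigma>)\<close>. Submultiplicativity of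
  \<open>\<tau>\<close> bounds \<open>\<tau>(n)\<^sup>2\<close> by the convolution of \<open>\<tau>\<close> with itself, and \<open>\<tau>\<close> is the convolution of \<open>1\<close> with itself, so
  the series is dominated by the fourth power of the zeta function at \<open>\<sigma> - 1 > 1\<close>.
\<close>

lemma summable_h_coeff:
  assumes "\<sigma> > 2"
  shows "summable (\<lambda>n. real_of_int (h_coeff (Suc n)) * real (Suc n) powr (-\<sigma>))"
proof -
  define u where "u n = real n powr (1 - \<sigma>)" for n
  define v where "v n = real (divisor_count n) * u n" for n
  have u_mult: "u d * u (n div d) = u n" if "d dvd n" for d n
    using that by (cases "d = 0") (auto simp: u_def powr_mult[symmetric] real_of_nat_div)
  have "summable (\<lambda>n. real n powr (1 - \<sigma>))"
    using assms by (simp add: summable_real_powr_iff)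
  hence u: "summable (\<lambda>n. u (Suc n))" unfolding u_def by (subst summable_Suc_iff)
  have "(\<Sum>d | d dvd n. u d * u (n div d)) = v n" for n
    by (simp add: u_mult v_def divisor_count_def)
  with summable_convolution[OF _ _ u u] have v: "summable (\<lambda>n. v (Suc n))"
    by (simp add: u_def)
  have "summable (\<lambda>n. \<Sum>d | d dvd Suc n. v d * v (Suc n div d))"
    by (rule summable_convolution[OF _ _ v v]) (simp_all add: v_def u_def)
  thus ?thesis
  proof (rule summable_comparison_test'[where N = 0])
    fix k :: nat
    define n where "n = Suc k"
    have n: "n > 0" by (simp add: n_def)
    have h: "0 \<le> h_coeff n" "h_coeff n \<le> int (n * divisor_count n ^ 2)"
      using cofactor_bounds[OF n] h_coeff_eq_cofactor[OF n] by simp_all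
    hence "real_of_int (h_coeff n) \<le> real_of_int (int (n * divisor_count n ^ 2))"
      by (simp only: of_int_le_iff)
    hence "real_of_int (h_coeff n) * real n powr (-\<sigma>) \<le> real n * real (divisor_count n) ^ 2 * real n powr (-\<sigma>)"
      by (intro mult_right_mono) auto
    also have "\<dots> = (\<Sum>d | d dvd n. real (divisor_count n) * u n)"
      using n by (simp add: u_def divisor_count_def[symmetric] power2_eq_square powr_diff powr_minus field_simps)
    also have "\<dots> \<le> (\<Sum>d | d dvd n. v d * v (n div d))"
    proof (rule sum_mono)
      fix d assume d: "d \<in> {d. d dvd n}"
      then obtain e where e: "n = d * e" by auto
      hence "d > 0" "e > 0" using n by auto
      hence "real (divisor_count n) \<le> real (divisor_count d * divisor_count (n div d))"
        using divisor_count_mult_le[of d e] e by (simp only: of_nat_le_iff) simp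
      hence "real (divisor_count n) * u n \<le> real (divisor_count d * divisor_count (n div d)) * u n"
        by (rule mult_right_mono) (simp add: u_def)
      also have "\<dots> = v d * v (n div d)"
        using u_mult[of d n] d by (simp add: v_def mult_ac)
      finally show "real (divisor_count n) * u n \<le> v d * v (n div d)" .
    qed
    finally show "norm (real_of_int (h_coeff (Suc k)) * real (Suc k) powr - \<sigma>) \<le>
        (\<Sum>d | d dvd Suc k. v d * v (Suc k div d))"
      using h by (simp add: n_def)
  qed
qed

section \<open>The sum of \<open>m\<^sup>2 \<tau>(m)\<close>\<close>

text \<open>
  The main terms for the sums of \<open>\<tau>(m)\<close> and of \<open>m\<^sup>2 \<tau>(m)\<close>. Their derivatives \<open>ln y + 2\<gamma>\<close> and
  \<open>y\<^sup>2 (ln y + 2\<gamma>)\<close> differ by the weight \<open>y\<^sup>2\<close>, which is the reason why the second one goes with the first.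
\<close>

definition divisor_main :: "real \<Rightarrow> real" where
  "divisor_main y = y * ln y + (2 * euler_mascheroni - 1) * y"

definition weighted_main :: "real \<Rightarrow> real" where
  "weighted_main y = y ^ 3 / 3 * (ln y + 2 * euler_mascheroni - 1 / 3)"

definition weighted_sum :: "real \<Rightarrow> real" where
  "weighted_sum y = (\<Sum>m = 1..nat \<lfloor>y\<rfloor>. real (m\<^sup>2 * divisor_count m))"

definition weighted_error :: "real \<Rightarrow> real" where
  "weighted_error y = weighted_sum y - weighted_main y"

lemma has_real_derivative_divisor_main:
  "y > 0 \<Longrightarrow> (divisor_main has_real_derivative (ln y + 2 * euler_mascheroni)) (at y)"
  unfolding divisor_main_def by (auto intro!: derivative_eq_intros simp: field_simps)

lemma has_real_derivative_weighted_main: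
  "y > 0 \<Longrightarrow> (weighted_main has_real_derivative y\<^sup>2 * (ln y + 2 * euler_mascheroni)) (at y)"
  unfolding weighted_main_def
  by (auto intro!: derivative_eq_intros simp: field_simps power2_eq_square power3_eq_cube)

text \<open>
  Summation by parts only uses the error at positive integers, where the asymptotic bound can be made uniform
  by enlarging the constant by the finitely many remaining values.
\<close>

lemma divisor_error_nat_bound:
  assumes "divisor_problem_bound t" "\<epsilon> > 0" "t + \<epsilon> \<ge> 0"
  obtains C where "C \<ge> 0" "\<And>n. n > 0 \<Longrightarrow> \<bar>divisor_error (real n)\<bar> \<le> C * real n powr (t + \<epsilon>)"
proof -
  have "divisor_error \<in> O(\<lambda>x. x powr (t + \<epsilon>))"
    using assms by (simp add: divisor_problem_bound_def)
  then obtain c where c: "c > 0" "eventually (\<lambda>x. \<bar>divisor_error x\<bar> \<le> c * \<bar>x powr (t + \<epsilon>)\<bar>) at_top"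
    by (elim landau_o.bigE) auto
  have "eventually (\<lambda>n. \<bar>divisor_error (real n)\<bar> \<le> c * \<bar>real n powr (t + \<epsilon>)\<bar>) sequentially"
    by (rule eventually_compose_filterlim[OF c(2) filterlim_real_sequentially])
  then obtain N where N: "\<And>n. n \<ge> N \<Longrightarrow> \<bar>divisor_error (real n)\<bar> \<le> c * real n powr (t + \<epsilon>)"
    by (auto simp: eventually_sequentially)
  define C where "C = c + (\<Sum>n<N. \<bar>divisor_error (real n)\<bar>)"
  have "\<bar>divisor_error (real n)\<bar> \<le> C * real n powr (t + \<epsilon>)" if "n > 0" for n
  proof (cases "n < N")
    case True
    have "\<bar>divisor_error (real n)\<bar> \<le> (\<Sum>n<N. \<bar>divisor_error (real n)\<bar>)"
      using True by (intro member_le_sum[where f = "\<lambda>n. \<bar>divisor_error (real n)\<bar>"]) auto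
    hence "\<bar>divisor_error (real n)\<bar> \<le> C * 1" using c(1) by (simp add: C_def)
    also have "\<dots> \<le> C * real n powr (t + \<epsilon>)"
      using that assms(3) c(1) by (intro mult_left_mono ge_one_powr_ge_zero) (auto simp: C_def intro!: add_nonneg_nonneg sum_nonneg)
    finally show ?thesis .
  next
    case False
    have "\<bar>divisor_error (real n)\<bar> \<le> c * real n powr (t + \<epsilon>)" using N False by simp
    also have "\<dots> \<le> C * real n powr (t + \<epsilon>)"
      by (intro mult_right_mono) (auto simp: C_def intro!: sum_nonneg)
    finally show ?thesis .
  qed
  moreover have "C \<ge> 0" using c(1) by (auto simp: C_def intro!: add_nonneg_nonneg sum_nonneg)
  ultimately show ?thesis using that by blast
qed

lemma abs_ln_plus_const_le:
  fixes y \<alpha> c :: real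
  assumes "y \<ge> 1" "\<alpha> > 0"
  shows "\<bar>ln y + c\<bar> \<le> (1 / \<alpha> + \<bar>c\<bar>) * y powr \<alpha>"
proof -
  have "\<bar>c\<bar> * 1 \<le> \<bar>c\<bar> * y powr \<alpha>"
    using assms by (intro mult_left_mono ge_one_powr_ge_zero) auto
  moreover have "ln y \<le> y powr \<alpha> / \<alpha>" using assms by (intro ln_powr_bound) auto
  moreover have "ln y \<ge> 0" using assms by simp
  ultimately show ?thesis by (simp add: distrib_right)
qed

text \<open>
  Summation by parts, in a discrete form that splits off the main terms: replacing \<open>\<tau>(m)\<close> by the increment of
  main term plus error, the increments of the main terms almost cancel. Since \<open>ln 0 = 0\<close>, all terms at \<open>0\<close>
  vanish and the identity starts at \<open>N = 0\<close>.
\<close>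

lemma weighted_error_Abel:
  defines "G \<equiv> (\<lambda>m. divisor_main (real m))" and "P \<equiv> (\<lambda>m. weighted_main (real m))"
  shows "weighted_error (real N) = (real N)\<^sup>2 * divisor_error (real N)
     - (\<Sum>m<N. (2 * real m + 1) * divisor_error (real m))
     + (\<Sum>m<N. (real (Suc m))\<^sup>2 * (G (Suc m) - G m) - (P (Suc m) - P m))"
proof (induction N)
  case 0
  thus ?case by (simp add: weighted_error_def weighted_sum_def weighted_main_def)
next
  case (Suc N)
  have D: "divisor_error (real m) = (\<Sum>n=1..m. real (divisor_count n)) - G m" for m
    by (simp add: divisor_error_def G_def divisor_main_def)
  have E: "weighted_error (real m) = (\<Sum>n=1..m. real (n\<^sup>2 * divisor_count n)) - P m" for m
    by (simp add: weighted_error_def weighted_sum_def P_def)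
  have tau: "real (divisor_count (Suc N)) = divisor_error (real (Suc N)) - divisor_error (real N) + (G (Suc N) - G N)"
    unfolding D by simp
  have "weighted_error (real (Suc N)) = weighted_error (real N) +
      (real (Suc N))\<^sup>2 * real (divisor_count (Suc N)) - (P (Suc N) - P N)"
    unfolding E by simp
  also have "\<dots> = weighted_error (real N) + (real (Suc N))\<^sup>2 * (divisor_error (real (Suc N)) - divisor_error (real N))
      + ((real (Suc N))\<^sup>2 * (G (Suc N) - G N) - (P (Suc N) - P N))"
    unfolding tau by (simp only: distrib_left)
  also have "(real (Suc N))\<^sup>2 * (divisor_error (real (Suc N)) - divisor_error (real N)) =
      (real (Suc N))\<^sup>2 * divisor_error (real (Suc N)) - (real N)\<^sup>2 * divisor_error (real N)
      - (2 * real N + 1) * divisor_error (real N)"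
    by (simp add: algebra_simps power2_eq_square)
  finally show ?case unfolding Suc.IH sum.lessThan_Suc by linarith
qed

text \<open>
  By the mean value theorem for \<open>(m + 1)\<^sup>2 G(y) - P(y)\<close>, with \<open>G\<close> and \<open>P\<close> the two main terms, whose derivative
  \<open>((m + 1)\<^sup>2 - y\<^sup>2)(ln y + 2\<gamma>)\<close> is small on \<open>[m, m + 1]\<close>.
\<close>

lemma weighted_main_increment_bound:
  assumes "m > 0" "\<alpha> > 0"
  shows "\<bar>(real (Suc m))\<^sup>2 * (divisor_main (real (Suc m)) - divisor_main (real m))
            - (weighted_main (real (Suc m)) - weighted_main (real m))\<bar>
         \<le> 2 * (1 / \<alpha> + \<bar>2 * euler_mascheroni\<bar>) * real (Suc m) powr (1 + \<alpha>)"
proof -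
  define M where "M = real (Suc m)"
  define f where "f y = M\<^sup>2 * divisor_main y - weighted_main y" for y
  define f' where "f' y = (M\<^sup>2 - y\<^sup>2) * (ln y + 2 * euler_mascheroni)" for y
  have der: "(f has_real_derivative f' y) (at y)" if "y > 0" for y
    unfolding f_def f'_def
    by (rule derivative_eq_intros has_real_derivative_divisor_main has_real_derivative_weighted_main that refl)+
       (simp add: algebra_simps)
  have "\<exists>z>real m. z < M \<and> f M - f (real m) = (M - real m) * f' z"
    using assms by (intro MVT2 der) (auto simp: M_def)
  then obtain z where z: "real m < z" "z < M" "f M - f (real m) = f' z"
    by (auto simp: M_def)
  have z1: "z \<ge> 1" using z assms by linarith
  have "\<bar>f' z\<bar> = (M\<^sup>2 - z\<^sup>2) * \<bar>ln z + 2 * euler_mascheroni\<bar>"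
    unfolding f'_def abs_mult using z z1 by (simp add: power_mono)
  also have "\<dots> \<le> (2 * M) * ((1 / \<alpha> + \<bar>2 * euler_mascheroni\<bar>) * M powr \<alpha>)"
  proof (rule mult_mono)
    have "(real m)\<^sup>2 \<le> z\<^sup>2" using z by (intro power_mono) auto
    thus "M\<^sup>2 - z\<^sup>2 \<le> 2 * M" by (simp add: M_def power2_eq_square algebra_simps)
    have "\<bar>ln z + 2 * euler_mascheroni\<bar> \<le> (1 / \<alpha> + \<bar>2 * euler_mascheroni\<bar>) * z powr \<alpha>"
      by (rule abs_ln_plus_const_le[OF z1 assms(2)])
    also have "\<dots> \<le> (1 / \<alpha> + \<bar>2 * euler_mascheroni\<bar>) * M powr \<alpha>"
      using z z1 assms by (intro mult_left_mono powr_mono2) auto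
    finally show "\<bar>ln z + 2 * euler_mascheroni\<bar> \<le> (1 / \<alpha> + \<bar>2 * euler_mascheroni\<bar>) * M powr \<alpha>" .
  qed (auto simp: M_def)
  also have "\<dots> = 2 * (1 / \<alpha> + \<bar>2 * euler_mascheroni\<bar>) * M powr (1 + \<alpha>)"
    by (simp add: powr_add M_def algebra_simps)
  finally show ?thesis
    unfolding z(3)[symmetric] by (simp add: f_def M_def algebra_simps)
qed

lemma weighted_error_nat_bound:
  assumes \<alpha>: "\<alpha> > 0" and C: "C \<ge> 0" "\<And>n. n > 0 \<Longrightarrow> \<bar>divisor_error (real n)\<bar> \<le> C * real n powr \<alpha>"
  obtains C' where "C' \<ge> 0" "\<And>n. n > 0 \<Longrightarrow> \<bar>weighted_error (real n)\<bar> \<le> C' * real n powr (2 + \<alpha>)"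
proof -
  define G where "G = (\<lambda>m. divisor_main (real m))"
  define P where "P = (\<lambda>m. weighted_main (real m))"
  define B where "B m = (real (Suc m))\<^sup>2 * (G (Suc m) - G m) - (P (Suc m) - P m)" for m
  define K where "K = 2 * (1 / \<alpha> + \<bar>2 * euler_mascheroni\<bar>) + \<bar>B 0\<bar>"
  have K: "K \<ge> 0" using \<alpha> by (auto simp: K_def intro!: add_nonneg_nonneg)
  have zero: "divisor_error 0 = 0" by (simp add: divisor_error_def)
  have B: "\<bar>B m\<bar> \<le> K * real (Suc m) powr (1 + \<alpha>)" for m
  proof (cases "m = 0")
    case True
    thus ?thesis using \<alpha> by (simp add: K_def)
  next
    case False
    have "\<bar>B m\<bar> \<le> 2 * (1 / \<alpha> + \<bar>2 * euler_mascheroni\<bar>) * real (Suc m) powr (1 + \<alpha>)"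
      unfolding B_def G_def P_def using False \<alpha> by (intro weighted_main_increment_bound) auto
    also have "\<dots> \<le> K * real (Suc m) powr (1 + \<alpha>)"
      by (intro mult_right_mono) (auto simp: K_def)
    finally show ?thesis .
  qed
  have "\<bar>weighted_error (real N)\<bar> \<le> (3 * C + K) * real N powr (2 + \<alpha>)" if N: "N > 0" for N
  proof -
    have pow: "real N powr (2 + \<alpha>) = (real N)\<^sup>2 * real N powr \<alpha>"
      "real N powr (2 + \<alpha>) = real N * real N powr (1 + \<alpha>)"
      using N by (simp_all add: powr_add power2_eq_square)
    have "\<bar>(real N)\<^sup>2 * divisor_error (real N)\<bar> \<le> (real N)\<^sup>2 * (C * real N powr \<alpha>)"
      unfolding abs_mult using C(2)[OF N] by (intro mult_mono) auto
    hence 1: "\<bar>(real N)\<^sup>2 * divisor_error (real N)\<bar> \<le> C * real N powr (2 + \<alpha>)"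
      by (simp add: pow(1) mult_ac)
    have "\<bar>\<Sum>m<N. (2 * real m + 1) * divisor_error (real m)\<bar> \<le>
        (\<Sum>m<N. \<bar>(2 * real m + 1) * divisor_error (real m)\<bar>)" by (rule sum_abs)
    also have "\<dots> \<le> (\<Sum>m<N. (2 * real N) * (C * real N powr \<alpha>))"
    proof (rule sum_mono)
      fix m assume m: "m \<in> {..<N}"
      have "\<bar>divisor_error (real m)\<bar> \<le> C * real N powr \<alpha>"
      proof (cases "m = 0")
        case False
        have "\<bar>divisor_error (real m)\<bar> \<le> C * real m powr \<alpha>" using False by (intro C(2)) auto
        also have "\<dots> \<le> C * real N powr \<alpha>" using m \<alpha> C(1) by (intro mult_left_mono powr_mono2) auto
        finally show ?thesis .
      qed (use zero C(1) in auto)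
      thus "\<bar>(2 * real m + 1) * divisor_error (real m)\<bar> \<le> (2 * real N) * (C * real N powr \<alpha>)"
        unfolding abs_mult using m by (intro mult_mono) auto
    qed
    also have "\<dots> = 2 * C * real N powr (2 + \<alpha>)"
      unfolding pow(1) by (simp add: power2_eq_square)
    finally have 2: "\<bar>\<Sum>m<N. (2 * real m + 1) * divisor_error (real m)\<bar> \<le> 2 * C * real N powr (2 + \<alpha>)" .
    have "\<bar>\<Sum>m<N. B m\<bar> \<le> (\<Sum>m<N. \<bar>B m\<bar>)" by (rule sum_abs)
    also have "\<dots> \<le> (\<Sum>m<N. K * real N powr (1 + \<alpha>))"
    proof (rule sum_mono)
      fix m assume m: "m \<in> {..<N}"
      have "K * real (Suc m) powr (1 + \<alpha>) \<le> K * real N powr (1 + \<alpha>)"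
        using m \<alpha> K by (intro mult_left_mono powr_mono2) auto
      with B[of m] show "\<bar>B m\<bar> \<le> K * real N powr (1 + \<alpha>)" by linarith
    qed
    also have "\<dots> = K * real N powr (2 + \<alpha>)" unfolding pow(2) by simp
    finally have 3: "\<bar>\<Sum>m<N. B m\<bar> \<le> K * real N powr (2 + \<alpha>)" .
    have "weighted_error (real N) = (real N)\<^sup>2 * divisor_error (real N)
        - (\<Sum>m<N. (2 * real m + 1) * divisor_error (real m)) + (\<Sum>m<N. B m)"
      unfolding B_def G_def P_def by (rule weighted_error_Abel)
    with 1 2 3 show ?thesis by (simp add: distrib_right)
  qed
  moreover have "3 * C + K \<ge> 0" using C(1) K by simp
  ultimately show ?thesis using that by blast
qed

text \<open>
  Between consecutive integers the sum is constant, while the main term changes by at most its derivative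
  \<open>O(y\<^sup>2 ln y)\<close>, which the exponent \<open>2 + \<alpha>\<close> absorbs.
\<close>

lemma weighted_error_bound_ge_1:
  assumes \<alpha>: "\<alpha> > 0" and C: "C \<ge> 0" "\<And>n. n > 0 \<Longrightarrow> \<bar>weighted_error (real n)\<bar> \<le> C * real n powr (2 + \<alpha>)"
    and y: "y \<ge> 1"
  shows "\<bar>weighted_error y\<bar> \<le> (C + (1 / \<alpha> + \<bar>2 * euler_mascheroni\<bar>)) * y powr (2 + \<alpha>)"
proof -
  define c where "c = 1 / \<alpha> + \<bar>2 * euler_mascheroni :: real\<bar>"
  have c: "c \<ge> 0" using \<alpha> by (simp add: c_def)
  define N where "N = nat \<lfloor>y\<rfloor>"
  have N: "N > 0" "real N \<le> y" "y < real N + 1"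
    using y by (auto simp: N_def le_floor_iff)
  have "weighted_sum y = weighted_sum (real N)" by (simp add: weighted_sum_def N_def)
  hence eq: "weighted_error y = weighted_error (real N) - (weighted_main y - weighted_main (real N))"
    by (simp add: weighted_error_def)
  have "\<bar>weighted_main y - weighted_main (real N)\<bar> \<le> c * y powr (2 + \<alpha>)"
  proof (cases "y = real N")
    case False
    with N have Ny: "real N < y" by simp
    have "\<exists>z>real N. z < y \<and> weighted_main y - weighted_main (real N) =
        (y - real N) * (z\<^sup>2 * (ln z + 2 * euler_mascheroni))"
      using N Ny by (intro MVT2 has_real_derivative_weighted_main) auto
    then obtain z where z: "real N < z" "z < y" "weighted_main y - weighted_main (real N) =
        (y - real N) * (z\<^sup>2 * (ln z + 2 * euler_mascheroni))" by blast
    have z1: "z \<ge> 1" using z N by linarith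
    have "\<bar>weighted_main y - weighted_main (real N)\<bar> = (y - real N) * (z\<^sup>2 * \<bar>ln z + 2 * euler_mascheroni\<bar>)"
      unfolding z(3) abs_mult using N by simp
    also have "\<dots> \<le> 1 * (y\<^sup>2 * (c * y powr \<alpha>))"
    proof (intro mult_mono)
      have "\<bar>ln z + 2 * euler_mascheroni\<bar> \<le> c * z powr \<alpha>"
        unfolding c_def by (rule abs_ln_plus_const_le[OF z1 \<alpha>])
      also have "\<dots> \<le> c * y powr \<alpha>"
        using z z1 \<alpha> c by (intro mult_left_mono powr_mono2) auto
      finally show "\<bar>ln z + 2 * euler_mascheroni\<bar> \<le> c * y powr \<alpha>" .
    qed (use z z1 N y in \<open>auto intro!: power_mono\<close>)
    also have "\<dots> = c * y powr (2 + \<alpha>)"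
      using y by (simp add: powr_add)
    finally show ?thesis .
  qed (use c in auto)
  moreover have "\<bar>weighted_error (real N)\<bar> \<le> C * y powr (2 + \<alpha>)"
  proof -
    have "\<bar>weighted_error (real N)\<bar> \<le> C * real N powr (2 + \<alpha>)" by (rule C(2)[OF N(1)])
    also have "\<dots> \<le> C * y powr (2 + \<alpha>)" using N C(1) \<alpha> by (intro mult_left_mono powr_mono2) auto
    finally show ?thesis .
  qed
  ultimately show ?thesis unfolding eq c_def[symmetric] by (simp add: distrib_right)
qed

text \<open>
  For \<open>y < 1\<close> the sum is empty and the error is the main term itself. A bound there replaces a separate
  estimate of the tails of the series for \<open>H(3)\<close> and \<open>H'(3)\<close>. The main term is of size \<open>y\<^sup>3 |ln y|\<close>, so any exponent below
  \<open>3\<close> is possible; \<open>5/2\<close> is convenient.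
\<close>

lemma weighted_error_bound_less_1:
  assumes "0 < y" "y < 1" "\<beta> \<le> 1 / 2"
  shows "\<bar>weighted_error y\<bar> \<le> (2 + \<bar>2 * euler_mascheroni - 1 / 3\<bar>) * y powr (2 + \<beta>)"
proof -
  define c where "c = \<bar>2 * euler_mascheroni - 1 / 3 :: real\<bar>"
  have "weighted_sum y = 0" using assms by (simp add: weighted_sum_def)
  hence "\<bar>weighted_error y\<bar> = y ^ 3 / 3 * \<bar>ln y + (2 * euler_mascheroni - 1 / 3)\<bar>"
    using assms by (simp add: weighted_error_def weighted_main_def abs_mult add_diff_eq)
  also have "\<dots> \<le> y ^ 3 * (\<bar>ln y\<bar> + c)"
  proof (rule mult_mono)
    show "y ^ 3 / 3 \<le> y ^ 3" using assms by simp
    show "\<bar>ln y + (2 * euler_mascheroni - 1 / 3)\<bar> \<le> \<bar>ln y\<bar> + c"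
      unfolding c_def by (rule abs_triangle_ineq)
  qed (use assms in auto)
  also have "\<dots> \<le> y ^ 3 * ((2 + c) * y powr (- (1 / 2)))"
  proof (rule mult_left_mono)
    have "ln (1 / y) \<le> (1 / y) powr (1 / 2) / (1 / 2)"
      using assms by (intro ln_powr_bound) auto
    hence "\<bar>ln y\<bar> \<le> 2 * y powr (- (1 / 2))"
      using assms by (simp add: ln_div powr_divide powr_minus field_simps)
    moreover have "c * 1 \<le> c * y powr (- (1 / 2))"
    proof (rule mult_left_mono)
      have "y powr 0 \<le> y powr (- (1 / 2))" using assms by (intro powr_mono') auto
      thus "1 \<le> y powr (- (1 / 2))" using assms by simp
    qed (simp add: c_def)
    ultimately show "\<bar>ln y\<bar> + c \<le> (2 + c) * y powr (- (1 / 2))" by (simp add: distrib_right)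
  qed (use assms in auto)
  also have "\<dots> = (2 + c) * y powr (2 + 1 / 2)"
  proof -
    have "y ^ 3 = y powr 3" using assms by simp
    thus ?thesis by (simp flip: powr_add)
  qed
  also have "\<dots> \<le> (2 + c) * y powr (2 + \<beta>)"
    using assms by (intro mult_left_mono powr_mono') (auto simp: c_def)
  finally show ?thesis by (simp add: c_def)
qed

text \<open>
  The two powers serve the ranges \<open>y \<ge> 1\<close> and \<open>y < 1\<close>. Keeping both gives one bound that is valid for
  all \<open>y > 0\<close>, whether or not \<open>t + \<epsilon>\<close> is below \<open>1\<close>.
\<close>

lemma weighted_error_bound:
  assumes "divisor_problem_bound t" "\<epsilon> > 0" "t + \<epsilon> > 0" "\<beta> \<le> 1 / 2"
  obtains C where "C \<ge> 0"
    "\<And>y. y > 0 \<Longrightarrow> \<bar>weighted_error y\<bar> \<le> C * (y powr (2 + (t + \<epsilon>)) + y powr (2 + \<beta>))"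
proof -
  obtain C1 where "C1 \<ge> 0" "\<And>n. n > 0 \<Longrightarrow> \<bar>divisor_error (real n)\<bar> \<le> C1 * real n powr (t + \<epsilon>)"
    using divisor_error_nat_bound[OF assms(1,2)] assms(3) by (metis less_imp_le)
  then obtain C2 where C2: "C2 \<ge> 0" "\<And>n. n > 0 \<Longrightarrow> \<bar>weighted_error (real n)\<bar> \<le> C2 * real n powr (2 + (t + \<epsilon>))"
    using weighted_error_nat_bound[OF assms(3)] by metis
  define A where "A = C2 + (1 / (t + \<epsilon>) + \<bar>2 * euler_mascheroni :: real\<bar>)"
  define B where "B = 2 + \<bar>2 * euler_mascheroni - 1 / 3 :: real\<bar>"
  have AB: "A \<ge> 0" "B \<ge> 0" using C2(1) assms(3) by (auto simp: A_def B_def)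
  have "\<bar>weighted_error y\<bar> \<le> (A + B) * (y powr (2 + (t + \<epsilon>)) + y powr (2 + \<beta>))" if "y > 0" for y
  proof -
    have "\<bar>weighted_error y\<bar> \<le> A * y powr (2 + (t + \<epsilon>)) \<or> \<bar>weighted_error y\<bar> \<le> B * y powr (2 + \<beta>)"
      using weighted_error_bound_ge_1[OF assms(3) C2, of y] weighted_error_bound_less_1[OF that _ assms(4)]
      by (cases "y \<ge> 1") (auto simp: A_def B_def)
    moreover have "0 \<le> A * y powr (2 + (t + \<epsilon>))" "0 \<le> B * y powr (2 + \<beta>)"
      "0 \<le> B * y powr (2 + (t + \<epsilon>))" "0 \<le> A * y powr (2 + \<beta>)" using AB by simp_all
    ultimately show ?thesis unfolding distrib_left distrib_right by linarith
  qed
  with AB that[of "A + B"] show ?thesis by auto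
qed

section \<open>The asymptotic formula\<close>

text \<open>
  The sum over \<open>d\<close> is written as an infinite series although its terms vanish for \<open>d > x\<close>. In this form the
  series of main terms can be subtracted term by term.
\<close>

lemma sum_subgroup_count_eq:
  assumes "x \<ge> 1"
  shows "(\<lambda>k. real_of_int (h_coeff (Suc k)) * weighted_sum (x / real (Suc k))) sums
           (\<Sum>n = 1..nat \<lfloor>x\<rfloor>. real (subgroup_count n))"
proof -
  define N where "N = nat \<lfloor>x\<rfloor>"
  define F where "F d m = real_of_int (h_coeff d) * real (m\<^sup>2 * divisor_count m)" for d m
  have div: "nat \<lfloor>x / real d\<rfloor> = N div d" for d
    using assms floor_divide_real_eq_div[of "int d" x] by (simp add: N_def nat_div_distrib)
  have s: "real (subgroup_count n) = (\<Sum>d | d dvd n. F d (n div d))" if "n > 0" for n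
  proof -
    have "real (subgroup_count n) = real_of_int (int (subgroup_count n))" by simp
    also have "\<dots> = (\<Sum>d | d dvd n. F (n div d) d)"
      unfolding subgroup_count_eq[OF that] F_def by (simp add: mult_ac)
    also have "\<dots> = (\<Sum>d | d dvd n. F d (n div d))"
      using that
      by (intro sum.reindex_bij_witness[of _ "\<lambda>d. n div d" "\<lambda>d. n div d"]) (auto elim!: dvdE)
    finally show ?thesis .
  qed
  have "(\<Sum>n = 1..N. real (subgroup_count n)) = (\<Sum>n = 1..N. \<Sum>d | d dvd n. F d (n div d))"
    by (intro sum.cong refl s) auto
  also have "\<dots> = (\<Sum>d = 1..N. \<Sum>m = 1..N div d. F d m)"
    by (rule sum_convolution)
  also have "\<dots> = (\<Sum>d = 1..N. real_of_int (h_coeff d) * weighted_sum (x / real d))"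
    unfolding weighted_sum_def div F_def sum_distrib_left ..
  also have "\<dots> = (\<Sum>k<N. real_of_int (h_coeff (Suc k)) * weighted_sum (x / real (Suc k)))"
    by (rule sum.reindex_bij_witness[of _ Suc "\<lambda>n. n - 1"]) auto
  finally show ?thesis
    unfolding N_def[symmetric]
  proof (elim ssubst, intro sums_finite)
    fix k assume "k \<notin> {..<N}"
    hence "N div Suc k = 0" by simp
    thus "real_of_int (h_coeff (Suc k)) * weighted_sum (x / real (Suc k)) = 0"
      unfolding weighted_sum_def div by simp
  qed simp
qed

definition H_value :: real where
  "H_value = (\<Sum>k. real_of_int (h_coeff (Suc k)) * real (Suc k) powr (-3))"

definition H_slope :: real where
  "H_slope = (\<Sum>k. - (real_of_int (h_coeff (Suc k)) * ln (real (Suc k)) * real (Suc k) powr (-3)))"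

lemma h_coeff_nonneg: "h_coeff n \<ge> 0"
  using cofactor_bounds[of n] h_coeff_eq_cofactor[of n] by (cases "n = 0") (auto simp: h_coeff.simps[of 0])

lemma summable_h_coeff_ln:
  assumes "\<sigma> > 2"
  shows "summable (\<lambda>k. real_of_int (h_coeff (Suc k)) * ln (real (Suc k)) * real (Suc k) powr (-\<sigma>))"
proof -
  define \<delta> where "\<delta> = (\<sigma> - 2) / 2"
  have \<delta>: "\<delta> > 0" "\<sigma> - \<delta> > 2" using assms by (auto simp: \<delta>_def field_simps)
  have "summable (\<lambda>k. 1 / \<delta> * (real_of_int (h_coeff (Suc k)) * real (Suc k) powr (-(\<sigma> - \<delta>))))"
    by (intro summable_mult summable_h_coeff \<delta>)
  thus ?thesis
  proof (rule summable_comparison_test'[where N = 0])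
    fix k :: nat
    have "ln (real (Suc k)) \<le> real (Suc k) powr \<delta> / \<delta>"
      using \<delta> by (intro ln_powr_bound) auto
    hence "real_of_int (h_coeff (Suc k)) * ln (real (Suc k)) * real (Suc k) powr (-\<sigma>) \<le>
        real_of_int (h_coeff (Suc k)) * (real (Suc k) powr \<delta> / \<delta>) * real (Suc k) powr (-\<sigma>)"
      using h_coeff_nonneg \<delta> by (intro mult_mono) (auto intro!: divide_nonneg_pos mult_nonneg_nonneg)
    also have "\<dots> = 1 / \<delta> * (real_of_int (h_coeff (Suc k)) * real (Suc k) powr (-(\<sigma> - \<delta>)))"
      by (simp add: powr_diff powr_minus field_simps)
    finally show "norm (real_of_int (h_coeff (Suc k)) * ln (real (Suc k)) * real (Suc k) powr (-\<sigma>)) \<le>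
        1 / \<delta> * (real_of_int (h_coeff (Suc k)) * real (Suc k) powr (-(\<sigma> - \<delta>)))"
      using h_coeff_nonneg by (simp add: abs_mult)
  qed
qed

text \<open>
  Termwise differentiation: on the disc of radius \<open>1/2\<close> around \<open>3\<close> the real part is at least \<open>5/2\<close>, so the
  differentiated series is dominated by a convergent one.
\<close>

lemma H_series_3: "H_series 3 = complex_of_real H_value"
  and deriv_H_series_3: "deriv H_series 3 = complex_of_real H_slope"
proof -
  define f where "f k z = of_int (h_coeff (Suc k)) * of_nat (Suc k) powr (- z)" for k and z :: complex
  define f' where "f' k z = - (of_int (h_coeff (Suc k)) * Ln (of_nat (Suc k)) * of_nat (Suc k) powr (- z))"
    for k and z :: complex
  have pw: "of_nat (Suc k) powr (- 3 :: complex) = of_real (real (Suc k) powr (-3))" for k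
  proof -
    have "(of_real (real (Suc k)) :: complex) powr of_real (-3) = of_real (real (Suc k) powr (-3))"
      by (rule powr_of_real) auto
    thus ?thesis by simp
  qed
  have f3: "f k 3 = of_real (real_of_int (h_coeff (Suc k)) * real (Suc k) powr (-3))" for k
    unfolding f_def pw by simp
  have Ln: "Ln (of_nat (Suc k)) = of_real (ln (real (Suc k)))" for k
    using Ln_of_real[of "real (Suc k)"] by simp
  have f'3: "f' k 3 = of_real (- (real_of_int (h_coeff (Suc k)) * ln (real (Suc k)) * real (Suc k) powr (-3)))" for k
    unfolding f'_def pw Ln by simp
  show "H_series 3 = complex_of_real H_value"
    unfolding H_series_def H_value_def
    by (subst suminf_of_real[OF summable_h_coeff]) (auto simp: f3[unfolded f_def] simp del: of_nat_Suc)
  define S where "S = ball (3 :: complex) (1 / 2)"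
  have "uniformly_convergent_on S (\<lambda>n z. \<Sum>k<n. f' k z)"
  proof (rule Weierstrass_m_test'[OF _ summable_h_coeff_ln[of "5/2"]])
    fix k z assume "z \<in> S"
    hence "\<bar>Re (3 - z)\<bar> < 1 / 2"
      using abs_Re_le_cmod[of "3 - z"] by (simp add: S_def dist_norm)
    hence z: "Re z \<ge> 5 / 2" unfolding abs_less_iff by simp
    have "norm (of_nat (Suc k) powr (- z)) = real (Suc k) powr (- Re z)"
      by (subst norm_powr_real_powr) auto
    also have "\<dots> \<le> real (Suc k) powr (- (5 / 2))"
      using z by (intro powr_mono) auto
    finally have "norm (of_nat (Suc k) powr (- z)) \<le> real (Suc k) powr (- (5 / 2))" .
    thus "norm (f' k z) \<le> real_of_int (h_coeff (Suc k)) * ln (real (Suc k)) * real (Suc k) powr (- (5 / 2))"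
      unfolding f'_def Ln norm_mult norm_minus_cancel
      using h_coeff_nonneg by (intro mult_mono) auto
  qed auto
  moreover have "(f k has_field_derivative f' k z) (at z within S)" for k z
  proof -
    have "((\<lambda>z. of_nat (Suc k) powr (- z)) has_field_derivative
        (Ln (of_nat (Suc k)) * of_nat (Suc k) powr (- z)) * (- 1)) (at z within S)"
      by (rule DERIV_chain2[OF has_field_derivative_powr_right])
         (auto intro!: derivative_eq_intros simp del: of_nat_Suc)
    from DERIV_cmult[OF this, of "of_int (h_coeff (Suc k))"] show ?thesis
      unfolding f_def f'_def by (simp add: mult_ac del: of_nat_Suc)
  qed
  moreover have "summable (\<lambda>k. f k 3)"
    unfolding f3 by (intro summable_of_real summable_h_coeff) auto
  ultimately have "((\<lambda>z. \<Sum>k. f k z) has_field_derivative (\<Sum>k. f' k 3)) (at 3)"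
    by (intro has_field_derivative_series'(2)[where S = S and x0 = 3]) (auto simp: S_def)
  hence "deriv H_series 3 = (\<Sum>k. f' k 3)"
    by (intro DERIV_imp_deriv) (simp add: f_def H_series_def[abs_def])
  also have "\<dots> = complex_of_real H_slope"
    unfolding f'3 H_slope_def by (rule suminf_of_real[symmetric]) (intro summable_minus summable_h_coeff_ln, simp)
  finally show "deriv H_series 3 = complex_of_real H_slope" .
qed

lemma weighted_main_sums:
  assumes "x > 0"
  shows "(\<lambda>k. real_of_int (h_coeff (Suc k)) * weighted_main (x / real (Suc k))) sums
           (x ^ 3 / 3 * (H_value * (ln x + 2 * euler_mascheroni - 1 / 3) + H_slope))"
proof -
  have "(\<lambda>k. real_of_int (h_coeff (Suc k)) * real (Suc k) powr (-3)) sums H_value"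
    unfolding H_value_def by (intro summable_sums summable_h_coeff) auto
  moreover have "(\<lambda>k. - (real_of_int (h_coeff (Suc k)) * ln (real (Suc k)) * real (Suc k) powr (-3))) sums H_slope"
    unfolding H_slope_def by (intro summable_sums summable_minus summable_h_coeff_ln) auto
  ultimately have "(\<lambda>k. x ^ 3 / 3 * (real_of_int (h_coeff (Suc k)) * real (Suc k) powr (-3) *
      (ln x + 2 * euler_mascheroni - 1 / 3) +
      - (real_of_int (h_coeff (Suc k)) * ln (real (Suc k)) * real (Suc k) powr (-3)))) sums
      (x ^ 3 / 3 * (H_value * (ln x + 2 * euler_mascheroni - 1 / 3) + H_slope))"
    by (intro sums_mult sums_add sums_mult2)
  moreover have "x ^ 3 / 3 * (real_of_int (h_coeff (Suc k)) * real (Suc k) powr (-3) *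
      (ln x + 2 * euler_mascheroni - 1 / 3) +
      - (real_of_int (h_coeff (Suc k)) * ln (real (Suc k)) * real (Suc k) powr (-3))) =
      real_of_int (h_coeff (Suc k)) * weighted_main (x / real (Suc k))" for k
  proof -
    define d where "d = real (Suc k)"
    have d: "d > 0" by (simp add: d_def)
    have "ln (x / d) = ln x - ln d" using assms d by (simp add: ln_div)
    moreover have "d powr (-3) = 1 / d ^ 3" using d by (simp add: powr_minus_divide)
    ultimately have main: "weighted_main (x / d) =
        x ^ 3 / 3 * d powr (-3) * (ln x - ln d + 2 * euler_mascheroni - 1 / 3)"
      by (simp add: weighted_main_def power_divide)
    show ?thesis
      unfolding d_def[symmetric] main by (simp add: algebra_simps)
  qed
  ultimately show ?thesis by simp
qed

theorem theorem2p3: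
  fixes \<epsilon> :: real
  assumes "\<epsilon> > 0"
  shows "(\<lambda>x::real. complex_of_real (\<Sum>n = 1..nat \<lfloor>x\<rfloor>. real (subgroup_count n)) -
            complex_of_real (x ^ 3 / 3) *
              (H_series 3 * complex_of_real (ln x + 2 * euler_mascheroni - 1 / 3) + deriv H_series 3))
         \<in> O[at_top](\<lambda>x. complex_of_real (x powr (2 + theta + \<epsilon>)))"
proof -
  define \<alpha> where "\<alpha> = theta + \<epsilon>"
  \<comment> \<open>With this choice the bound for small arguments is available, and it is not weaker
    than required: \<open>\<beta> \<le> \<alpha>\<close>, while \<open>\<beta> > 0\<close> keeps the series for \<open>h\<close> at \<open>2 + \<beta>\<close> convergent.\<close>
  define \<beta> where "\<beta> = min \<alpha> (1 / 2)"
  have "theta \<ge> 0" by (rule divisor_problem_bound_nonneg[OF divisor_problem_bound_theta])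
  hence \<alpha>: "\<alpha> > 0" using assms by (simp add: \<alpha>_def)
  hence \<beta>: "\<beta> > 0" "\<beta> \<le> \<alpha>" by (simp_all add: \<beta>_def)
  have \<beta>_half: "\<beta> \<le> 1 / 2" unfolding \<beta>_def by (rule min.cobounded2)
  obtain C where C: "C \<ge> 0"
    "\<And>y. y > 0 \<Longrightarrow> \<bar>weighted_error y\<bar> \<le> C * (y powr (2 + \<alpha>) + y powr (2 + \<beta>))"
    using weighted_error_bound[OF divisor_problem_bound_theta assms _ \<beta>_half] \<alpha> unfolding \<alpha>_def by metis
  define h where "h k = real_of_int (h_coeff (Suc k))" for k
  have h: "h k \<ge> 0" for k by (simp add: h_def h_coeff_nonneg)
  define Z where "Z \<sigma> = (\<Sum>k. h k * real (Suc k) powr (-\<sigma>))" for \<sigma>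
  have Z: "(\<lambda>k. h k * real (Suc k) powr (-\<sigma>)) sums Z \<sigma>" if "\<sigma> > 2" for \<sigma>
    unfolding Z_def h_def by (intro summable_sums summable_h_coeff that)
  define S where "S x = (\<Sum>n = 1..nat \<lfloor>x\<rfloor>. real (subgroup_count n))" for x :: real
  define M where "M x = x ^ 3 / 3 * (H_value * (ln x + 2 * euler_mascheroni - 1 / 3) + H_slope)" for x
  have bound: "\<bar>S x - M x\<bar> \<le> C * (Z (2 + \<alpha>) + Z (2 + \<beta>)) * x powr (2 + theta + \<epsilon>)" if x: "x \<ge> 1" for x
  proof -
    \<comment> \<open>Subtracting the series of main terms leaves only errors, including those for \<open>k + 1 > x\<close>.\<close>
    have "(\<lambda>k. h k * weighted_error (x / real (Suc k))) sums (S x - M x)"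
      using sums_diff[OF sum_subgroup_count_eq[OF x] weighted_main_sums[of x]] x
      by (simp add: S_def M_def h_def weighted_error_def right_diff_distrib del: of_nat_Suc)
    moreover have up: "(\<lambda>k. C * (x powr (2 + \<alpha>) * (h k * real (Suc k) powr (-(2 + \<alpha>))) +
        x powr (2 + \<beta>) * (h k * real (Suc k) powr (-(2 + \<beta>))))) sums
        (C * (x powr (2 + \<alpha>) * Z (2 + \<alpha>) + x powr (2 + \<beta>) * Z (2 + \<beta>)))"
      using \<alpha> \<beta> by (intro sums_mult sums_add Z) auto
    moreover have le: "\<bar>h k * weighted_error (x / real (Suc k))\<bar> \<le>
        C * (x powr (2 + \<alpha>) * (h k * real (Suc k) powr (-(2 + \<alpha>))) +
        x powr (2 + \<beta>) * (h k * real (Suc k) powr (-(2 + \<beta>))))" for k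
    proof -
      have "\<bar>h k * weighted_error (x / real (Suc k))\<bar> \<le>
          h k * (C * ((x / real (Suc k)) powr (2 + \<alpha>) + (x / real (Suc k)) powr (2 + \<beta>)))"
        unfolding abs_mult using h[of k] x by (intro mult_mono C(2)) auto
      moreover have "(x / real (Suc k)) powr s = x powr s * real (Suc k) powr (-s)" for s
        using x by (simp add: powr_divide powr_minus_divide)
      ultimately show ?thesis by (simp add: algebra_simps)
    qed
    ultimately have "\<bar>S x - M x\<bar> \<le> C * (x powr (2 + \<alpha>) * Z (2 + \<alpha>) + x powr (2 + \<beta>) * Z (2 + \<beta>))"
    proof -
      assume diff: "(\<lambda>k. h k * weighted_error (x / real (Suc k))) sums (S x - M x)"
      have "norm (\<Sum>k. h k * weighted_error (x / real (Suc k))) \<le>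
          (\<Sum>k. C * (x powr (2 + \<alpha>) * (h k * real (Suc k) powr (-(2 + \<alpha>))) +
            x powr (2 + \<beta>) * (h k * real (Suc k) powr (-(2 + \<beta>)))))"
        by (rule norm_suminf_le[OF _ sums_summable[OF up]]) (use le in \<open>simp only: real_norm_def\<close>)
      thus ?thesis using sums_unique[OF diff] sums_unique[OF up] by simp
    qed
    also have "\<dots> \<le> C * (x powr (2 + \<alpha>) * Z (2 + \<alpha>) + x powr (2 + \<alpha>) * Z (2 + \<beta>))"
    proof -
      have "Z (2 + \<beta>) \<ge> 0" using h \<beta> by (intro sums_le[OF _ sums_zero Z]) auto
      thus ?thesis using C(1) x \<beta> by (intro mult_left_mono add_left_mono mult_right_mono powr_mono) auto
    qed
    also have "\<dots> = C * (Z (2 + \<alpha>) + Z (2 + \<beta>)) * x powr (2 + theta + \<epsilon>)"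
      by (simp add: \<alpha>_def algebra_simps)
    finally show ?thesis .
  qed
  have "(\<lambda>x. complex_of_real (S x) - complex_of_real (x ^ 3 / 3) *
          (H_series 3 * complex_of_real (ln x + 2 * euler_mascheroni - 1 / 3) + deriv H_series 3))
      = (\<lambda>x. complex_of_real (S x - M x))"
    unfolding H_series_3 deriv_H_series_3 M_def by (simp only: of_real_mult of_real_add of_real_diff)
  moreover have "(\<lambda>x. complex_of_real (S x - M x)) \<in> O(\<lambda>x. complex_of_real (x powr (2 + theta + \<epsilon>)))"
  proof (rule bigoI[of _ "C * (Z (2 + \<alpha>) + Z (2 + \<beta>))"])
    show "eventually (\<lambda>x. norm (complex_of_real (S x - M x)) \<le>
        C * (Z (2 + \<alpha>) + Z (2 + \<beta>)) * norm (complex_of_real (x powr (2 + theta + \<epsilon>)))) at_top"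
      using eventually_ge_at_top[of 1] by eventually_elim (use bound in \<open>simp only: norm_of_real\<close>, simp)
  qed
  ultimately show ?thesis unfolding S_def by simp
qed

end
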